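(* Let $\{S_i\}_{i=1}^m$, $K$, $K^*$, $\mathbf p$, $\mu$, $F$, $s$, $\mathbf q$, $\chi(\mathbf q)$, $h(\mathbf q,\mathbf p)$ be as described in the context. Then there exists a set $M\subset K^*$ such that $$\mathcal H^s(K\setminus M)=0$$ and, for every subset $A\subset M$, $$\dim_{\mathrm H}F(A)=\frac{\chi(\mathbf q)}{h(\mathbf q,\mathbf p)}\,\dim_{\mathrm H}A.$$
   Context: Setting. Let $m\ge 2$ and $S_i(x)=r_ix+t_i$ ($i=1,\ldots,m$) on $\mathbb R$, with $0<r_i<1$ and $0=t_1<t_2<\cdots<t_m<r_m+t_m=1$. The intervals $S_i([0,1])$, $i=1,\ldots,m$, are assumed pairwise disjoint. Let $K\subset[0,1]$ be the unique nonempty compact set with $K=\bigcup_{i=1}^m S_i(K)$. Let $\mathbf p=(p_1,\ldots,p_m)$ be a probability vector with all $p_i>0$, let $\mu$ be the unique Borel probability measure on $\mathbb R$ with $\mu=\sum_{i=1}^m p_i\,\mu\circ S_i^{-1}$ (its support is $K$), and let $F(x)=\mu([0,x])$ be its distribution function. Let $K^1$ be the set of endpoints of the complementary intervals of $K$ in $\mathbb R$, i.e. of the connected components of $\mathbb R\setminus K$ (including the two unbounded ones, so $0,1\in K^1$), and $K^*=K\setminus K^1$. Let $s>0$ be the unique number with $\sum_{i=1}^m r_i^s=1$, and let $\mathbf q=(q_1,\ldots,q_m)$ with $q_i=r_i^s$. Set $$\chi(\mathbf q)=-\sum_{i=1}^m q_i\log r_i,\qquad h(\mathbf q,\mathbf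 p)=-\sum_{i=1}^m q_i\log p_i.$$ $\mathcal H^s$ denotes $s$-dimensional Hausdorff measure and $\dim_{\mathrm H}$ Hausdorff dimension. *)

theory Defs
  imports "HOL-Probability.Probability"
begin

(* The d-th power of the diameter, with the convention that nonempty sets contribute 1 when
   d = 0 (so that the 0-dimensional Hausdorff measure is counting measure) and that the
   empty set always contributes 0. The separate case is needed since 0 powr 0 = 0. *)
definition diam_pow :: "real \<Rightarrow> 'a::metric_space set \<Rightarrow> ennreal" where
  "diam_pow d U = (if U = {} then 0 else if d = 0 then 1 else ennreal (diameter U powr d))"

(* Boundedness is required explicitly because the library's diameter is a real number and is
   unspecified on unbounded sets. Finite covers are included by padding with empty sets. *)
definition delta_covers :: "real \<Rightarrow> 'a::metric_space set \<Rightarrow> (nat \<Rightarrow> 'a set) set" where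
  "delta_covers \<delta> A = {U. A \<subseteq> (\<Union>n. U n) \<and> (\<forall>n. bounded (U n) \<and> diameter (U n) \<le> \<delta>)}"

definition hausdorff_premeasure :: "real \<Rightarrow> real \<Rightarrow> 'a::metric_space set \<Rightarrow> ennreal" where
  "hausdorff_premeasure d \<delta> A = (INF U\<in>delta_covers \<delta> A. \<Sum>n. diam_pow d (U n))"

(* An outer measure, defined on all subsets. *)
definition hausdorff_measure :: "real \<Rightarrow> 'a::metric_space set \<Rightarrow> ennreal" where
  "hausdorff_measure d A = (SUP \<delta>\<in>{0<..}. hausdorff_premeasure d \<delta> A)"

definition hausdorff_dim :: "'a::metric_space set \<Rightarrow> ennreal" where
  "hausdorff_dim A = (INF d\<in>{d. 0 \<le> d \<and> hausdorff_measure d A = 0}. ennreal d)"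

definition sim_map :: "(nat \<Rightarrow> real) \<Rightarrow> (nat \<Rightarrow> real) \<Rightarrow> nat \<Rightarrow> real \<Rightarrow> real" where
  "sim_map r t i x = r i * x + t i"

(* For closed K the components of - K are open intervals, possibly unbounded, and the frontier
   of such an interval is the set of its finite endpoints. *)
definition gap_endpoints :: "real set \<Rightarrow> real set" where
  "gap_endpoints K = (\<Union>I\<in>components (- K). frontier I)"

definition lyapunov_exponent :: "nat \<Rightarrow> (nat \<Rightarrow> real) \<Rightarrow> (nat \<Rightarrow> real) \<Rightarrow> real" where
  "lyapunov_exponent m r q = - (\<Sum>i=1..m. q i * ln (r i))"

definition cross_entropy :: "nat \<Rightarrow> (nat \<Rightarrow> real) \<Rightarrow> (nat \<Rightarrow> real) \<Rightarrow> real" where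
  "cross_entropy m q p = - (\<Sum>i=1..m. q i * ln (p i))"

end

theory Submission
  imports Defs "HOL-Library.Sublist"
begin

text \<open>Code the points of \<open>K\<close> by words over \<open>{1..m}\<close>. A word \<open>w\<close> stands for a cylinder, the image
  of \<open>K\<close> under the composition of the maps named by its letters. The cylinder lies in an
  interval whose length is the product \<open>r w\<close> of the contraction ratios, and \<open>F\<close> rises across
  this interval by the product \<open>p w\<close> of the probabilities.

  For \<open>d > 0\<close> a subset of \<open>K\<close> is null for \<open>d\<close>-dimensional Hausdorff measure if and only if it
  can be covered by cylinders whose sum of the \<open>d\<close>-th powers of \<open>r w\<close> is arbitrarily small, and
  its image under \<open>F\<close> is null if and only if the same can be done with \<open>p w\<close> in place of \<open>r w\<close>.
  The reason is the same in both cases: cutting all words when their weight first drops to \<open>\<rho>\<close>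
  yields intervals that do not overlap and have length comparable to \<open>\<rho>\<close>, and a set of diameter
  at most \<open>\<rho>\<close> meets only boundedly many of them (\<open>few_stopping_words_meet\<close>,
  \<open>hausdorff_null_iff_word_null\<close>). Passing from a set to its image therefore means changing the
  weights on covers by words.

  The set \<open>M\<close> consists of the points \<open>x\<close> that are not endpoints of gaps and for which all words
  \<open>w\<close> of length \<open>n\<close> at \<open>x\<close> satisfy \<open>ln (r w) = - n * \<chi> + o(n)\<close> and \<open>ln (p w) = - n * h + o(n)\<close>,
  where \<open>\<chi>\<close> and \<open>h\<close> are the Lyapunov exponent and the cross entropy. Along such words \<open>p w\<close> is
  \<open>r w\<close> to the power \<open>h / \<chi>\<close> up to an arbitrarily small error in the exponent, so a cover that
  is small for \<open>r\<close> and \<open>d\<close> is small for \<open>p\<close> and every exponent above \<open>d * \<chi> / h\<close>, and conversely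
  (\<open>word_null_transfer\<close>). This gives both inequalities between the dimensions for every subset
  of \<open>M\<close>.

  The remaining points of \<open>K\<close> are null: there are countably many endpoints of gaps, and the law
  of large numbers for letters with probabilities \<open>q i = r i powr s\<close> takes care of the rest.
  Because the probability of a word is \<open>r w\<close> to the power \<open>s\<close>, an exponential bound for the
  probability of a deviation at length \<open>n\<close> is at the same time a bound for the cost of covering
  the deviating points (\<open>word_null_large_deviation\<close>, \<open>word_null_nontypical\<close>).\<close>

section \<open>Hausdorff null sets and Hausdorff dimension\<close>

lemma ennreal_le_suminf: "f n \<le> suminf f" for f :: "nat \<Rightarrow> ennreal"
  using sum_le_suminf[of f "{n}"] by simp

lemma suminf_geometric_half:
  assumes "0 \<le> c" shows "(\<Sum>n. ennreal (c * (1/2) ^ Suc n)) = ennreal c"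
proof -
  have "(\<lambda>n. c * (1/2) ^ Suc n) sums (c * 1)"
    by (intro sums_mult power_half_series)
  thus ?thesis using assms by (intro suminf_ennreal_eq) auto
qed

text \<open>For positive exponents the mesh bound in the definition is harmless: a cover whose total
  \<open>d\<close>-th power is small consists of small sets.\<close>

lemma hausdorff_measure_eq_0_iff:
  fixes A :: "'a::metric_space set"
  assumes d: "0 < d"
  shows "hausdorff_measure d A = 0 \<longleftrightarrow>
    (\<forall>\<eta>>0. \<exists>U. A \<subseteq> (\<Union>n. U n) \<and> (\<forall>n. bounded (U n)) \<and>
       (\<Sum>n. ennreal (diameter (U n) powr d)) \<le> ennreal \<eta>)" (is "_ \<longleftrightarrow> ?R")
proof -
  have dp: "diam_pow d U = ennreal (diameter U powr d)" for U :: "'a set"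
    using d by (auto simp: diam_pow_def)
  show ?thesis
  proof
    assume H: "hausdorff_measure d A = 0"
    have "hausdorff_premeasure d 1 A \<le> hausdorff_measure d A"
      unfolding hausdorff_measure_def by (intro SUP_upper) auto
    hence H1: "hausdorff_premeasure d 1 A = 0" using H by simp
    show ?R
    proof (intro allI impI)
      fix \<eta> :: real assume "\<eta> > 0"
      hence "hausdorff_premeasure d 1 A < ennreal \<eta>" using H1 by simp
      then obtain U where "U \<in> delta_covers 1 A" "(\<Sum>n. diam_pow d (U n)) < ennreal \<eta>"
        unfolding hausdorff_premeasure_def by (auto simp: INF_less_iff)
      thus "\<exists>U. A \<subseteq> (\<Union>n. U n) \<and> (\<forall>n. bounded (U n)) \<and>
         (\<Sum>n. ennreal (diameter (U n) powr d)) \<le> ennreal \<eta>"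
        by (intro exI[of _ U]) (auto simp: delta_covers_def dp less_imp_le)
    qed
  next
    assume R: ?R
    have "hausdorff_premeasure d \<delta> A \<le> 0" if \<delta>: "\<delta> > 0" for \<delta>
    proof (rule ennreal_le_epsilon)
      fix e :: real assume e: "e > 0"
      define \<eta> where "\<eta> = min e (\<delta> powr d)"
      have \<eta>: "\<eta> > 0" using e \<delta> by (simp add: \<eta>_def)
      obtain U where U: "A \<subseteq> (\<Union>n. U n)" "\<And>n. bounded (U n)"
         "(\<Sum>n. ennreal (diameter (U n) powr d)) \<le> ennreal \<eta>"
        using R[rule_format, OF \<eta>] by (elim exE conjE) metis
      have "diameter (U n) \<le> \<delta>" for n
      proof -
        have "ennreal (diameter (U n) powr d) \<le> (\<Sum>n. ennreal (diameter (U n) powr d))"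
          by (rule ennreal_le_suminf)
        also have "\<dots> \<le> ennreal (\<delta> powr d)"
          by (rule order_trans[OF U(3)], rule ennreal_leI) (simp add: \<eta>_def)
        finally have "diameter (U n) powr d \<le> \<delta> powr d"
          by (simp add: ennreal_le_iff)
        thus ?thesis using powr_less_mono2[of d \<delta> "diameter (U n)"] d \<delta> by linarith
      qed
      hence "U \<in> delta_covers \<delta> A" using U by (auto simp: delta_covers_def)
      hence "hausdorff_premeasure d \<delta> A \<le> (\<Sum>n. diam_pow d (U n))"
        unfolding hausdorff_premeasure_def by (rule INF_lower)
      also have "\<dots> \<le> ennreal \<eta>" using U(3) by (simp add: dp)
      also have "\<dots> \<le> ennreal e" by (intro ennreal_leI) (simp add: \<eta>_def)
      finally show "hausdorff_premeasure d \<delta> A \<le> 0 + ennreal e" by simp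
    qed
    hence "hausdorff_measure d A \<le> 0"
      unfolding hausdorff_measure_def by (intro SUP_least) simp
    thus "hausdorff_measure d A = 0" by simp
  qed
qed

lemma hausdorff_measure_0_eq_0_iff: "hausdorff_measure 0 A = 0 \<longleftrightarrow> A = {}"
proof
  assume H: "hausdorff_measure 0 A = 0"
  have "hausdorff_premeasure 0 1 A \<le> hausdorff_measure 0 A"
    unfolding hausdorff_measure_def by (intro SUP_upper) auto
  hence "hausdorff_premeasure 0 1 A < 1" using H by simp
  then obtain U where U: "U \<in> delta_covers 1 A" "(\<Sum>n. diam_pow 0 (U n)) < 1"
    unfolding hausdorff_premeasure_def by (auto simp: INF_less_iff)
  have "U n = {}" for n
  proof (rule ccontr)
    assume "U n \<noteq> {}"
    hence "1 = diam_pow 0 (U n)" by (simp add: diam_pow_def)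
    also have "\<dots> \<le> (\<Sum>n. diam_pow 0 (U n))"
      by (rule ennreal_le_suminf)
    finally show False using U(2) by simp
  qed
  thus "A = {}" using U(1) by (auto simp: delta_covers_def)
next
  assume A: "A = {}"
  have "hausdorff_premeasure 0 \<delta> A \<le> 0" if "\<delta> > 0" for \<delta>
  proof -
    have "(\<lambda>_. {}) \<in> delta_covers \<delta> A" using A that by (auto simp: delta_covers_def diameter_def)
    from INF_lower[OF this, of "\<lambda>U. \<Sum>n. diam_pow 0 (U n)"]
    show ?thesis unfolding hausdorff_premeasure_def by (simp add: diam_pow_def)
  qed
  hence "hausdorff_measure 0 A \<le> 0"
    unfolding hausdorff_measure_def by (intro SUP_least) simp
  thus "hausdorff_measure 0 A = 0" by simp
qed

text \<open>Only null sets of positive exponents need to be compared. The exponent \<open>0\<close>, which occurs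
  in the infimum only for the empty set, is separate, because the covers by cylinders used below
  say nothing about it; and an arbitrarily small loss in the exponent does not change an
  infimum.\<close>

lemma hausdorff_dim_le_mult:
  assumes c: "0 < c"
    and null: "\<And>d e. \<lbrakk>0 < d; d * c < e; hausdorff_measure d A = 0\<rbrakk> \<Longrightarrow> hausdorff_measure e B = 0"
    and empty: "A = {} \<Longrightarrow> B = {}"
  shows "hausdorff_dim B \<le> ennreal c * hausdorff_dim A"
proof -
  have dimB: "hausdorff_dim B \<le> ennreal e" if "0 \<le> e" "hausdorff_measure e B = 0" for e
    unfolding hausdorff_dim_def using that by (intro INF_lower) auto
  have *: "hausdorff_dim B \<le> ennreal c * ennreal d" if d: "0 \<le> d" "hausdorff_measure d A = 0" for d
  proof (cases "d = 0")
    case True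
    hence "hausdorff_measure 0 B = 0" using d empty by (simp add: hausdorff_measure_0_eq_0_iff)
    thus ?thesis using dimB[of 0] by simp
  next
    case False
    hence d0: "0 < d" using d by simp
    show ?thesis
    proof (rule ennreal_le_epsilon)
      fix e :: real assume e: "0 < e"
      have "hausdorff_dim B \<le> ennreal (d * c + e)"
        using null[OF d0 _ d(2), of "d * c + e"] e d0 c by (intro dimB) auto
      thus "hausdorff_dim B \<le> ennreal c * ennreal d + ennreal e"
        using e d0 c by (simp add: ennreal_mult[symmetric] mult.commute)
    qed
  qed
  have "hausdorff_dim B / ennreal c \<le> hausdorff_dim A"
    unfolding hausdorff_dim_def[of A]
    by (intro INF_greatest divide_le_posI_ennreal) (use c * in auto)
  hence "ennreal c * (hausdorff_dim B / ennreal c) \<le> ennreal c * hausdorff_dim A"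
    by (rule mult_left_mono) simp
  thus ?thesis using c
    by (simp add: ennreal_times_divide mult.commute[of "ennreal c"] ennreal_mult_divide_eq)
qed

text \<open>An interval that misses one of its limit points lies on one side of it. The bound also
  covers the unbounded components, where one of \<open>Inf I\<close> and \<open>Sup I\<close> is an arbitrary real number:
  all that matters is that there are at most two frontier points.\<close>

lemma frontier_connected_real_subset:
  fixes I :: "real set"
  assumes "connected I" "open I"
  shows "frontier I \<subseteq> {Inf I, Sup I}"
proof
  fix x assume x: "x \<in> frontier I"
  hence xc: "x \<in> closure I" and xn: "x \<notin> I"
    using assms(2) by (auto simp: frontier_def interior_open)
  have "I \<noteq> {}" using xc by auto
  have near: "\<exists>y\<in>I. \<bar>y - x\<bar> < e" if "e > 0" for e
    using xc that by (auto simp: closure_approachable dist_real_def)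
  have "(\<forall>y\<in>I. y < x) \<or> (\<forall>y\<in>I. x < y)"
  proof (rule ccontr)
    assume "\<not> ?thesis"
    then obtain y z where "y \<in> I" "z \<in> I" "y \<le> x" "x \<le> z" by (auto simp: not_less)
    hence "x \<in> I" using assms(1) connected_contains_Icc[of I y z] by auto
    thus False using xn by simp
  qed
  thus "x \<in> {Inf I, Sup I}"
  proof
    assume lt: "\<forall>y\<in>I. y < x"
    have "Sup I = x"
    proof (rule cSup_eq_non_empty[OF \<open>I \<noteq> {}\<close>])
      fix b assume b: "\<And>y. y \<in> I \<Longrightarrow> y \<le> b"
      show "x \<le> b"
        using near[of "x - b"] b by (force simp: not_le[symmetric])
    qed (use lt in auto)
    thus ?thesis by simp
  next
    assume gt: "\<forall>y\<in>I. x < y"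
    have "Inf I = x"
    proof (rule cInf_eq_non_empty[OF \<open>I \<noteq> {}\<close>])
      fix b assume b: "\<And>y. y \<in> I \<Longrightarrow> b \<le> y"
      show "b \<le> x"
        using near[of "b - x"] b by (force simp: not_le[symmetric])
    qed (use gt in auto)
    thus ?thesis by simp
  qed
qed

lemma countable_gap_endpoints:
  assumes "closed K"
  shows "countable (gap_endpoints K)"
proof -
  have op: "open I" if "I \<in> components (- K)" for I
    using that assms by (meson open_Compl open_components)
  have "countable (components (- K))"
    using op pairwise_disjoint_components[of "- K"]
    by (intro countable_disjoint_open_subsets) (auto simp: pairwise_def disjoint_def disjnt_def)
  moreover have "countable (frontier I)" if "I \<in> components (- K)" for I
    using frontier_connected_real_subset[OF in_components_connected[OF that] op[OF that]]
    by (rule countable_subset) auto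
  ultimately show ?thesis unfolding gap_endpoints_def by (intro countable_UN) auto
qed

section \<open>Words, cylinders and their weights\<close>

definition word_map :: "(nat \<Rightarrow> real) \<Rightarrow> (nat \<Rightarrow> real) \<Rightarrow> nat list \<Rightarrow> real \<Rightarrow> real" where
  "word_map r t w = foldr (sim_map r t) w"

definition word_weight :: "(nat \<Rightarrow> real) \<Rightarrow> nat list \<Rightarrow> real" where
  "word_weight a w = prod_list (map a w)"

text \<open>The sum of the \<open>d\<close>-th powers of the weights of a possibly infinite set of words. As an
  integral against counting measure it is countably subadditive without reference to an
  enumeration.\<close>

definition word_content :: "(nat \<Rightarrow> real) \<Rightarrow> real \<Rightarrow> nat list set \<Rightarrow> ennreal" where
  "word_content a d W = (\<integral>\<^sup>+w. ennreal (word_weight a w powr d) * indicator W w \<partial>count_space UNIV)"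

lemma word_map_Nil [simp]: "word_map r t [] x = x"
  and word_map_Cons [simp]: "word_map r t (i # w) x = sim_map r t i (word_map r t w x)"
  and word_map_append [simp]: "word_map r t (u @ v) x = word_map r t u (word_map r t v x)"
  by (simp_all add: word_map_def)

lemma word_weight_Nil [simp]: "word_weight a [] = 1"
  and word_weight_Cons [simp]: "word_weight a (i # w) = a i * word_weight a w"
  and word_weight_append [simp]: "word_weight a (u @ v) = word_weight a u * word_weight a v"
  by (simp_all add: word_weight_def)

lemma word_content_mono: "W \<subseteq> W' \<Longrightarrow> word_content a d W \<le> word_content a d W'"
  unfolding word_content_def by (intro nn_integral_mono mult_left_mono) (auto simp: indicator_def)

lemma word_content_UN: "word_content a d (\<Union>n::nat. W n) \<le> (\<Sum>n. word_content a d (W n))"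
proof -
  have "word_content a d (\<Union>n. W n) \<le>
     (\<integral>\<^sup>+w. (\<Sum>n. ennreal (word_weight a w powr d) * indicator (W n) w) \<partial>count_space UNIV)"
    unfolding word_content_def
  proof (intro nn_integral_mono)
    fix w
    show "ennreal (word_weight a w powr d) * indicator (\<Union>n. W n) w
        \<le> (\<Sum>n. ennreal (word_weight a w powr d) * indicator (W n) w)"
    proof (cases "w \<in> (\<Union>n. W n)")
      case True
      then obtain n where "w \<in> W n" by auto
      thus ?thesis
        using True ennreal_le_suminf[of "\<lambda>n. ennreal (word_weight a w powr d) * indicator (W n) w" n]
        by simp
    qed simp
  qed
  also have "\<dots> = (\<Sum>n. word_content a d (W n))"
    unfolding word_content_def by (rule nn_integral_suminf) simp
  finally show ?thesis .
qed

lemma word_content_finite: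
  "finite W \<Longrightarrow> word_content a d W = ennreal (\<Sum>w\<in>W. word_weight a w powr d)"
  by (simp add: word_content_def nn_integral_count_space_indicator[symmetric]
      nn_integral_count_space_finite)

lemma word_content_ge_member: "w \<in> W \<Longrightarrow> ennreal (word_weight a w powr d) \<le> word_content a d W"
  using word_content_mono[of "{w}" W a d] by (simp add: word_content_finite)

text \<open>One cover is used for two weights and two exponents: this is how a dimension estimate is
  carried from the points to their images.\<close>

lemma word_content_le_transfer:
  assumes "\<And>w. w \<in> W \<Longrightarrow> word_weight b w powr e \<le> word_weight a w powr d"
  shows "word_content b e W \<le> word_content a d W"
  unfolding word_content_def
  by (intro nn_integral_mono) (auto simp: indicator_def intro!: ennreal_leI assms)

text \<open>The enumeration of the cover that the definition of Hausdorff measure asks for.\<close>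

lemma word_content_suminf:
  "word_content a d W = (\<Sum>n. ennreal (word_weight a (from_nat_into UNIV n) powr d)
                         * indicator W (from_nat_into UNIV n))"
proof -
  have "infinite (UNIV :: nat list set)" by (rule infinite_UNIV_listI)
  hence "bij_betw (from_nat_into (UNIV :: nat list set)) UNIV UNIV"
    by (intro bij_betw_from_nat_into) auto
  from nn_integral_bij_count_space[OF this, of "\<lambda>w. ennreal (word_weight a w powr d) * indicator W w"]
  show ?thesis by (simp add: word_content_def nn_integral_count_space_nat)
qed

section \<open>Bounds for the weight of a word\<close>

definition weight_on :: "nat \<Rightarrow> (nat \<Rightarrow> real) \<Rightarrow> bool" where
  "weight_on m a \<longleftrightarrow> (\<forall>i\<in>{1..m}. 0 < a i \<and> a i < 1)"

lemma word_weight_pos: "weight_on m a \<Longrightarrow> w \<in> lists {1..m} \<Longrightarrow> 0 < word_weight a w"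
  by (induction w) (auto simp: weight_on_def)

lemma word_weight_geometric:
  assumes "weight_on m a"
  shows "\<exists>\<rho>. 0 < \<rho> \<and> \<rho> < 1 \<and> (\<forall>w\<in>lists {1..m}. word_weight a w \<le> \<rho> ^ length w)"
proof (intro exI conjI ballI)
  define \<rho> where "\<rho> = Max (insert (1/2) (a ` {1..m}))"
  show "0 < \<rho>" unfolding \<rho>_def by (subst Max_gr_iff) auto
  show "\<rho> < 1" unfolding \<rho>_def using assms by (subst Max_less_iff) (auto simp: weight_on_def)
  have le: "a i \<le> \<rho>" if "i \<in> {1..m}" for i
    unfolding \<rho>_def by (rule Max_ge) (use that in auto)
  show "word_weight a w \<le> \<rho> ^ length w" if "w \<in> lists {1..m}" for w
    using that
  proof (induction w)
    case (Cons i w)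
    have "0 < a i" "a i \<le> \<rho>" "0 < word_weight a w" "word_weight a w \<le> \<rho> ^ length w"
      using Cons assms le[of i] word_weight_pos[OF assms, of w] by (auto simp: weight_on_def)
    thus ?case by (simp add: mult_mono)
  qed simp
qed

lemma weight_on_bounded_below:
  assumes "weight_on m a"
  shows "\<exists>\<kappa>. 0 < \<kappa> \<and> \<kappa> \<le> 1 \<and> (\<forall>i\<in>{1..m}. \<kappa> \<le> a i)"
proof (intro exI conjI ballI)
  define \<kappa> where "\<kappa> = Min (insert 1 (a ` {1..m}))"
  show "0 < \<kappa>" unfolding \<kappa>_def using assms by (subst Min_gr_iff) (auto simp: weight_on_def)
  show "\<kappa> \<le> 1" unfolding \<kappa>_def by (rule Min_le) auto
  show "\<kappa> \<le> a i" if "i \<in> {1..m}" for i unfolding \<kappa>_def by (rule Min_le) (use that in auto)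
qed

lemma power_powr_arbitrarily_small:
  assumes "0 < \<rho>" "\<rho> < 1" "0 < (d::real)" "0 < \<eta>"
  shows "\<exists>n. (\<rho> ^ n) powr d < \<eta>"
proof -
  have "0 < \<eta> powr (1 / d)" using assms by simp
  then obtain n where "\<rho> ^ n < \<eta> powr (1 / d)" using real_arch_pow_inv[OF _ assms(2)] by blast
  hence "(\<rho> ^ n) powr d < (\<eta> powr (1 / d)) powr d" using assms by (intro powr_less_mono2) auto
  thus ?thesis using assms by (intro exI[of _ n]) (simp add: powr_powr)
qed

section \<open>The geometry of the cylinders\<close>

locale self_similar_set =
  fixes m :: nat and r t :: "nat \<Rightarrow> real" and K :: "real set"
  assumes m: "2 \<le> m"
    and r: "\<And>i. i \<in> {1..m} \<Longrightarrow> 0 < r i \<and> r i < 1"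
    and t: "t 1 = 0" "strict_mono_on {1..m} t" "r m + t m = 1"
    and disjoint: "disjoint_family_on (\<lambda>i. sim_map r t i ` {0..1}) {1..m}"
    and K: "compact K" "K \<noteq> {}" "K = (\<Union>i\<in>{1..m}. sim_map r t i ` K)"
begin

abbreviation words :: "nat list set" where
  "words \<equiv> lists {1..m}"

abbreviation wmap :: "nat list \<Rightarrow> real \<Rightarrow> real" where
  "wmap \<equiv> word_map r t"

definition cyl :: "nat list \<Rightarrow> real set" where
  "cyl w = wmap w ` K"

lemma weight_on_r: "weight_on m r"
  using r by (simp add: weight_on_def)

lemma intervals_ordered:
  assumes "i \<in> {1..m}" "j \<in> {1..m}" "i < j"
  shows "r i + t i < t j"
proof (rule ccontr)
  assume ge: "\<not> r i + t i < t j"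
  have lt: "t i < t j" using t(2) assms by (simp add: strict_mono_on_def)
  have "t j = sim_map r t i ((t j - t i) / r i)" using r[OF assms(1)] by (simp add: sim_map_def)
  moreover have "(t j - t i) / r i \<in> {0..1}"
    using r[OF assms(1)] lt ge by (auto simp: divide_le_eq)
  ultimately have "t j \<in> sim_map r t i ` {0..1}" by blast
  moreover have "t j \<in> sim_map r t j ` {0..1}"
    by (rule image_eqI[of _ _ 0]) (auto simp: sim_map_def)
  ultimately show False using disjoint_family_onD[OF disjoint assms(1,2)] assms(3) by blast
qed

lemma interval_bounds:
  assumes "i \<in> {1..m}"
  shows "0 \<le> t i" "r i + t i \<le> 1"
proof -
  show "0 \<le> t i"
    using intervals_ordered[of 1 i] assms t(1) r[of 1] by (cases "i = 1") force+
  show "r i + t i \<le> 1"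
    using intervals_ordered[of i m] assms t(3) r[of m] by (cases "i = m") force+
qed

lemma wmap_mono: "w \<in> words \<Longrightarrow> x \<le> y \<Longrightarrow> wmap w x \<le> wmap w y"
proof (induction w)
  case (Cons i w)
  thus ?case using r[of i] by (auto simp: sim_map_def intro!: mult_left_mono)
qed simp

lemma sim_map_unit:
  assumes "i \<in> {1..m}" "x \<in> {0..1}"
  shows "sim_map r t i x \<in> {0..1}"
proof -
  have "0 \<le> r i * x" "r i * x \<le> r i"
    using assms r[of i] by (auto simp: mult_le_cancel_left1)
  thus ?thesis using interval_bounds[OF assms(1)] by (auto simp: sim_map_def)
qed

lemma wmap_unit: "w \<in> words \<Longrightarrow> x \<in> {0..1} \<Longrightarrow> wmap w x \<in> {0..1}"
  by (induction w) (auto simp del: atLeastAtMost_iff intro!: sim_map_unit)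

lemma wmap_length: "wmap w 1 - wmap w 0 = word_weight r w"
proof (induction w)
  case (Cons i w)
  have "wmap (i # w) 1 - wmap (i # w) 0 = r i * (wmap w 1 - wmap w 0)"
    by (simp add: sim_map_def algebra_simps)
  thus ?case using Cons by simp
qed simp

text \<open>Incomparable words branch at some letter, so their intervals lie in two different
  first-level intervals of a common cylinder and do not interlock. Their order is preserved by a
  monotone coordinate.\<close>

lemma parallel_words_ordered:
  assumes "v \<in> words" "w \<in> words" "v \<parallel> w"
  shows "wmap v 1 \<le> wmap w 0 \<or> wmap w 1 \<le> wmap v 0"
proof -
  have *: "wmap (u @ i # v') 1 \<le> wmap (u @ j # w') 0"
    if "u @ i # v' \<in> words" "u @ j # w' \<in> words" "i < j" for u i j v' w'
  proof -
    have ij: "i \<in> {1..m}" "j \<in> {1..m}" and w: "u \<in> words" "v' \<in> words" "w' \<in> words"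
      using that by auto
    have "r i * wmap v' 1 \<le> r i * 1"
      using r[OF ij(1)] wmap_unit[OF w(2), of 1] by (intro mult_left_mono) auto
    moreover have "0 \<le> r j * wmap w' 0"
      using r[OF ij(2)] wmap_unit[OF w(3), of 0] by auto
    ultimately have "sim_map r t i (wmap v' 1) \<le> sim_map r t j (wmap w' 0)"
      using intervals_ordered[OF ij that(3)] by (simp add: sim_map_def)
    thus ?thesis using w(1) by (simp add: wmap_mono)
  qed
  obtain u i v' j w' where "i \<noteq> j" "v = u @ i # v'" "w = u @ j # w'"
    using parallel_decomp[OF assms(3)] by blast
  thus ?thesis using *[of u i v' j w'] *[of u j w' i v'] assms(1,2)
    by (cases "i < j") auto
qed

text \<open>A point \<open>M\<close> of \<open>K\<close> that is maximal satisfies \<open>M \<le> r i * M + t i\<close> for some \<open>i\<close>, and the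
  fixed point of the \<open>i\<close>-th map is at most \<open>1\<close>; a minimal point is treated in the same way.\<close>

lemma K_unit: "K \<subseteq> {0..1}"
proof -
  obtain M where M: "M \<in> K" "\<And>x. x \<in> K \<Longrightarrow> x \<le> M"
    using compact_attains_sup[OF K(1,2)] by blast
  obtain N where N: "N \<in> K" "\<And>x. x \<in> K \<Longrightarrow> N \<le> x"
    using compact_attains_inf[OF K(1,2)] by blast
  have "M \<le> 1"
  proof -
    obtain i y where i: "i \<in> {1..m}" "y \<in> K" "M = sim_map r t i y" using M(1) K(3) by blast
    have "r i * y \<le> r i * M" using r[OF i(1)] M(2)[OF i(2)] by (intro mult_left_mono) auto
    hence "(1 - r i) * M \<le> (1 - r i) * 1"
      using i(3) interval_bounds(2)[OF i(1)] by (simp add: sim_map_def algebra_simps)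
    thus ?thesis using r[OF i(1)] by (simp add: mult_le_cancel_left)
  qed
  moreover have "0 \<le> N"
  proof -
    obtain i y where i: "i \<in> {1..m}" "y \<in> K" "N = sim_map r t i y" using N(1) K(3) by blast
    have "r i * N \<le> r i * y" using r[OF i(1)] N(2)[OF i(2)] by (intro mult_left_mono) auto
    hence "0 \<le> (1 - r i) * N"
      using i(3) interval_bounds(1)[OF i(1)] by (simp add: sim_map_def algebra_simps)
    thus ?thesis using r[OF i(1)] by (simp add: zero_le_mult_iff)
  qed
  ultimately show ?thesis using M(2) N(2) by force
qed

lemma cyl_Nil: "cyl [] = K"
  by (simp add: cyl_def)

lemma cyl_subset_K: "w \<in> words \<Longrightarrow> cyl w \<subseteq> K"
proof (induction w)
  case (Cons i w)
  hence "cyl w \<subseteq> K" "i \<in> {1..m}" by auto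
  hence "sim_map r t i ` cyl w \<subseteq> (\<Union>i\<in>{1..m}. sim_map r t i ` K)" by blast
  thus ?case using K(3) by (auto simp: cyl_def)
qed (simp add: cyl_Nil)

lemma cyl_append_subset: "v \<in> words \<Longrightarrow> cyl (u @ v) \<subseteq> cyl u"
  using cyl_subset_K[of v] by (auto simp: cyl_def)

lemma cyl_interval: "w \<in> words \<Longrightarrow> cyl w \<subseteq> {wmap w 0..wmap w 1}"
  using K_unit by (force simp: cyl_def intro!: wmap_mono)

lemma cylinder_at_depth:
  assumes "x \<in> K"
  shows "\<exists>w\<in>words. length w = n \<and> x \<in> cyl w"
proof (induction n)
  case 0
  show ?case using assms by (intro bexI[of _ "[]"]) (auto simp: cyl_Nil)
next
  case (Suc n)
  then obtain w y where w: "w \<in> words" "length w = n" "y \<in> K" "x = wmap w y"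
    by (auto simp: cyl_def)
  obtain i z where i: "i \<in> {1..m}" "z \<in> K" "y = sim_map r t i z" using w(3) K(3) by blast
  have "x \<in> cyl (w @ [i])" using w i by (auto simp: cyl_def)
  thus ?case using w i by (intro bexI[of _ "w @ [i]"]) auto
qed

section \<open>Sets that are null for covers by cylinders\<close>

text \<open>The analogue of a null set of Hausdorff measure in which only cylinders are used as
  covering sets and the weight \<open>a\<close> of a word replaces the diameter.\<close>

definition word_null :: "(nat \<Rightarrow> real) \<Rightarrow> real \<Rightarrow> real set \<Rightarrow> bool" where
  "word_null a d A \<longleftrightarrow>
    (\<forall>\<eta>>0. \<exists>W\<subseteq>words. A \<subseteq> (\<Union>w\<in>W. cyl w) \<and> word_content a d W \<le> ennreal \<eta>)"

lemma word_nullD: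
  assumes "word_null a d A" "0 < \<eta>"
  shows "\<exists>W. W \<subseteq> words \<and> A \<subseteq> (\<Union>w\<in>W. cyl w) \<and> word_content a d W \<le> ennreal \<eta>"
  using assms unfolding word_null_def by simp

lemma word_null_subset: "word_null a d B \<Longrightarrow> A \<subseteq> B \<Longrightarrow> word_null a d A"
  unfolding word_null_def by (meson order_trans)

lemma word_null_UN:
  assumes "\<And>n::nat. word_null a d (A n)"
  shows "word_null a d (\<Union>n. A n)"
  unfolding word_null_def
proof (intro allI impI)
  fix \<eta> :: real assume \<eta>: "0 < \<eta>"
  have "\<exists>W\<subseteq>words. A n \<subseteq> (\<Union>w\<in>W. cyl w) \<and> word_content a d W \<le> ennreal (\<eta> * (1/2) ^ Suc n)" for n
    using assms[of n] \<eta> unfolding word_null_def by simp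
  then obtain W where W: "\<And>n. W n \<subseteq> words" "\<And>n. A n \<subseteq> (\<Union>w\<in>W n. cyl w)"
     "\<And>n. word_content a d (W n) \<le> ennreal (\<eta> * (1/2) ^ Suc n)" by metis
  have "word_content a d (\<Union>n. W n) \<le> (\<Sum>n. ennreal (\<eta> * (1/2) ^ Suc n))"
    by (rule order_trans[OF word_content_UN]) (intro suminf_le W(3) summableI)
  also have "\<dots> = ennreal \<eta>" using \<eta> by (intro suminf_geometric_half) simp
  finally have "word_content a d (\<Union>n. W n) \<le> ennreal \<eta>" .
  moreover have "(\<Union>n. A n) \<subseteq> (\<Union>w\<in>(\<Union>n. W n). cyl w)" using W(2) by blast
  moreover have "(\<Union>n. W n) \<subseteq> words" using W(1) by blast
  ultimately show "\<exists>W\<subseteq>words. (\<Union>n. A n) \<subseteq> (\<Union>w\<in>W. cyl w) \<and> word_content a d W \<le> ennreal \<eta>"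
    by (intro exI[of _ "\<Union>n. W n"] conjI)
qed

lemma word_null_Un:
  assumes "word_null a d A" "word_null a d B"
  shows "word_null a d (A \<union> B)"
proof -
  have "word_null a d (\<Union>n::nat. if n = 0 then A else B)"
    by (rule word_null_UN) (simp add: assms)
  thus ?thesis by (rule word_null_subset) (auto split: if_splits intro: exI[of _ "0::nat"] exI[of _ "1::nat"])
qed

text \<open>Every point of \<open>K\<close> lies in cylinders of arbitrarily small weight.\<close>

lemma word_null_countable:
  assumes a: "weight_on m a" and d: "0 < d" and A: "countable A" "A \<subseteq> K"
  shows "word_null a d A"
proof -
  have single: "word_null a d {x}" if x: "x \<in> K" for x
    unfolding word_null_def
  proof (intro allI impI)
    fix \<eta> :: real assume \<eta>: "0 < \<eta>"
    obtain \<rho> where \<rho>: "0 < \<rho>" "\<rho> < 1" "\<And>w. w \<in> words \<Longrightarrow> word_weight a w \<le> \<rho> ^ length w"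
      using word_weight_geometric[OF a] by auto
    obtain n where n: "(\<rho> ^ n) powr d < \<eta>" using power_powr_arbitrarily_small[OF \<rho>(1,2) d \<eta>] ..
    obtain w where w: "w \<in> words" "length w = n" "x \<in> cyl w"
      using cylinder_at_depth[OF x] by blast
    have "word_weight a w powr d \<le> (\<rho> ^ n) powr d"
      using \<rho>(3)[OF w(1)] w(2) d word_weight_pos[OF a w(1)] by (intro powr_mono2) auto
    thus "\<exists>W\<subseteq>words. {x} \<subseteq> (\<Union>w\<in>W. cyl w) \<and> word_content a d W \<le> ennreal \<eta>"
      using w n by (intro exI[of _ "{w}"]) (auto simp: word_content_finite intro!: ennreal_leI)
  qed
  show ?thesis
  proof (cases "A = {}")
    case True
    thus ?thesis unfolding word_null_def by (intro allI impI exI[of _ "{}"]) (simp add: word_content_def)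
  next
    case False
    have "word_null a d (\<Union>n. {from_nat_into A n})"
      by (intro word_null_UN single subsetD[OF A(2)] from_nat_into False)
    moreover have "A = (\<Union>n. {from_nat_into A n})"
      using range_from_nat_into[OF False A(1)] by auto
    ultimately show ?thesis by simp
  qed
qed

end

section \<open>Hausdorff null sets of the image under a coordinate\<close>

text \<open>A coordinate is a monotone function that gives the interval of every word the weight of
  this word as its length. The two coordinates of interest are the identity, whose weights are
  products of contraction ratios, and the distribution function, whose weights are products of
  probabilities. Images of the intervals of two incomparable words may touch, as happens with
  the distribution function, which is constant on gaps, but they do not overlap.\<close>

locale coordinate = self_similar_set +
  fixes a :: "nat \<Rightarrow> real" and g :: "real \<Rightarrow> real"
  assumes a: "weight_on m a"
    and g_mono: "mono_on {0..1} g"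
    and g_length: "\<And>w. w \<in> words \<Longrightarrow> g (wmap w 1) - g (wmap w 0) = word_weight a w"
begin

lemma g_le: "x \<in> {0..1} \<Longrightarrow> y \<in> {0..1} \<Longrightarrow> x \<le> y \<Longrightarrow> g x \<le> g y"
  using g_mono by (simp add: mono_on_def)

lemma g_cyl:
  assumes "w \<in> words"
  shows "g ` cyl w \<subseteq> {g (wmap w 0)..g (wmap w 0) + word_weight a w}"
proof
  fix y assume "y \<in> g ` cyl w"
  then obtain x where x: "x \<in> cyl w" "y = g x" by blast
  have "x \<in> {0..1}" "wmap w 0 \<le> x" "x \<le> wmap w 1"
    using x(1) cyl_interval[OF assms] cyl_subset_K[OF assms] K_unit by auto
  moreover have "wmap w 0 \<in> {0..1}" "wmap w 1 \<in> {0..1}"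
    using wmap_unit[OF assms, of 0] wmap_unit[OF assms, of 1] by auto
  ultimately have "g (wmap w 0) \<le> y" "y \<le> g (wmap w 1)"
    unfolding x(2) by (auto intro!: g_le)
  thus "y \<in> {g (wmap w 0)..g (wmap w 0) + word_weight a w}"
    using g_length[OF assms] by auto
qed

lemma g_cyl_diameter:
  assumes "w \<in> words"
  shows "bounded (g ` cyl w)" "diameter (g ` cyl w) \<le> word_weight a w"
proof -
  show b: "bounded (g ` cyl w)" using g_cyl[OF assms] by (rule bounded_subset[rotated]) simp
  have "diameter (g ` cyl w) \<le> diameter {g (wmap w 0)..g (wmap w 0) + word_weight a w}"
    using g_cyl[OF assms] by (intro diameter_subset) auto
  thus "diameter (g ` cyl w) \<le> word_weight a w"
    using word_weight_pos[OF a assms] by simp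
qed

lemma hausdorff_null_if_word_null:
  assumes d: "0 < d" and A: "word_null a d A"
  shows "hausdorff_measure d (g ` A) = 0"
  unfolding hausdorff_measure_eq_0_iff[OF d]
proof (intro allI impI)
  fix \<eta> :: real assume \<eta>: "0 < \<eta>"
  obtain W where W: "W \<subseteq> words" "A \<subseteq> (\<Union>w\<in>W. cyl w)" "word_content a d W \<le> ennreal \<eta>"
    using word_nullD[OF A \<eta>] by auto
  define e :: "nat \<Rightarrow> nat list" where "e = from_nat_into UNIV"
  define U where "U n = (if e n \<in> W then g ` cyl (e n) else {})" for n
  have "surj e" unfolding e_def by (rule range_from_nat_into) auto
  have "g ` A \<subseteq> (\<Union>n. U n)"
  proof
    fix y assume "y \<in> g ` A"
    then obtain w where w: "w \<in> W" "y \<in> g ` cyl w" using W(2) by blast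
    obtain n where "w = e n" using \<open>surj e\<close> by blast
    hence "y \<in> U n" using w by (simp add: U_def)
    thus "y \<in> (\<Union>n. U n)" by blast
  qed
  moreover have "bounded (U n)" for n
    using g_cyl_diameter(1)[of "e n"] W(1) by (auto simp: U_def)
  moreover have "(\<Sum>n. ennreal (diameter (U n) powr d)) \<le> ennreal \<eta>"
  proof -
    have "ennreal (diameter (U n) powr d)
         \<le> ennreal (word_weight a (e n) powr d) * indicator W (e n)" for n
    proof (cases "e n \<in> W")
      case True
      hence "e n \<in> words" using W(1) by auto
      from g_cyl_diameter[OF this] True show ?thesis
        using d by (auto simp: U_def diameter_ge_0 intro!: ennreal_leI powr_mono2)
    next
      case False
      thus ?thesis by (simp add: U_def diameter_def)
    qed
    hence "(\<Sum>n. ennreal (diameter (U n) powr d)) \<le> word_content a d W"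
      unfolding word_content_suminf e_def by (intro suminf_le summableI) auto
    thus ?thesis using W(3) by (rule order_trans)
  qed
  ultimately show "\<exists>U. g ` A \<subseteq> (\<Union>n. U n) \<and> (\<forall>n. bounded (U n)) \<and>
      (\<Sum>n. ennreal (diameter (U n) powr d)) \<le> ennreal \<eta>"
    by (intro exI[of _ U] conjI allI)
qed

text \<open>The words that are cut off as soon as the weight drops to \<open>\<rho>\<close>. Their cylinders cover \<open>K\<close>,
  and for \<open>\<rho> < 1\<close> all their weights are comparable to \<open>\<rho>\<close>.\<close>

definition stopping_words :: "real \<Rightarrow> nat list set" where
  "stopping_words \<rho> =
     {w \<in> words. word_weight a w \<le> \<rho> \<and> (\<forall>u. strict_prefix u w \<longrightarrow> \<rho> < word_weight a u)}"

lemma stopping_words_cover: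
  assumes x: "x \<in> K" and \<rho>: "0 < \<rho>"
  shows "\<exists>w\<in>stopping_words \<rho>. x \<in> cyl w"
proof -
  define P where "P n \<longleftrightarrow> (\<exists>w\<in>words. length w = n \<and> x \<in> cyl w \<and> word_weight a w \<le> \<rho>)" for n
  obtain \<theta> where \<theta>: "0 < \<theta>" "\<theta> < 1" "\<And>w. w \<in> words \<Longrightarrow> word_weight a w \<le> \<theta> ^ length w"
    using word_weight_geometric[OF a] by auto
  obtain n where "\<theta> ^ n < \<rho>" using real_arch_pow_inv[OF \<rho> \<theta>(2)] by blast
  hence "P n" unfolding P_def using cylinder_at_depth[OF x, of n] \<theta>(3) by force
  hence "P (LEAST n. P n)" by (rule LeastI)
  then obtain w where w: "w \<in> words" "length w = (LEAST n. P n)" "x \<in> cyl w" "word_weight a w \<le> \<rho>"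
    unfolding P_def by blast
  have "\<rho> < word_weight a u" if u: "strict_prefix u w" for u
  proof (rule ccontr)
    assume le: "\<not> \<rho> < word_weight a u"
    obtain v where v: "w = u @ v" using u by (auto simp: strict_prefix_def prefix_def)
    hence "x \<in> cyl u" using w cyl_append_subset[of v u] by auto
    hence "P (length u)" unfolding P_def using le v w(1) by (intro bexI[of _ u]) auto
    hence "length w \<le> length u" unfolding w(2) by (rule Least_le)
    thus False using prefix_length_less[OF u] by simp
  qed
  thus ?thesis using w unfolding stopping_words_def by blast
qed

lemma stopping_words_parallel:
  assumes "v \<in> stopping_words \<rho>" "w \<in> stopping_words \<rho>" "v \<noteq> w"
  shows "v \<parallel> w"
  using assms unfolding stopping_words_def
  by (intro parallelI) (auto simp: strict_prefix_def not_less[symmetric])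

lemma stopping_words_weight_ge:
  assumes w: "w \<in> stopping_words \<rho>" and \<rho>: "0 \<le> \<rho>" "\<rho> < 1"
    and \<kappa>: "\<And>i. i \<in> {1..m} \<Longrightarrow> \<kappa> \<le> a i" "0 \<le> \<kappa>"
  shows "\<kappa> * \<rho> \<le> word_weight a w"
proof (cases w rule: rev_cases)
  case Nil
  thus ?thesis using w \<rho> by (simp add: stopping_words_def)
next
  case (snoc u i)
  have "strict_prefix u w" using snoc by (simp add: strict_prefix_def)
  hence "\<rho> < word_weight a u" "\<kappa> \<le> a i"
    using w snoc \<kappa>(1)[of i] by (auto simp: stopping_words_def)
  hence "\<rho> * \<kappa> \<le> word_weight a u * a i" using \<rho> \<kappa>(2) by (intro mult_mono) auto
  thus ?thesis using snoc by (simp add: mult.commute)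
qed

text \<open>The step that replaces an arbitrary covering set by cylinders. The left endpoints of the
  intervals of the stopping words for \<open>\<rho>\<close> are at mutual distance at least \<open>\<kappa> * \<rho>\<close>, where \<open>\<kappa>\<close>
  bounds the letter weights from below; if the intervals meet a set of diameter at most \<open>\<rho>\<close>,
  these endpoints lie in a range of length \<open>3 * \<rho>\<close>. The number of such words is hence bounded in
  terms of \<open>\<kappa>\<close> alone.\<close>

lemma few_stopping_words_meet:
  "\<exists>L::nat. \<forall>\<rho> V. 0 < \<rho> \<and> \<rho> < 1 \<and> bounded V \<and> diameter V \<le> \<rho> \<longrightarrow>
     (\<exists>W\<subseteq>words. finite W \<and> card W \<le> L \<and> (\<forall>w\<in>W. word_weight a w \<le> \<rho>) \<and>
        {x \<in> K. g x \<in> V} \<subseteq> (\<Union>w\<in>W. cyl w))"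
proof -
  obtain \<kappa> where \<kappa>: "0 < \<kappa>" "\<kappa> \<le> 1" "\<And>i. i \<in> {1..m} \<Longrightarrow> \<kappa> \<le> a i"
    using weight_on_bounded_below[OF a] by auto
  define Z where "Z = {\<lfloor>- (2 / \<kappa>)\<rfloor>..\<lfloor>1 / \<kappa>\<rfloor>}"
  have "\<exists>W\<subseteq>words. finite W \<and> card W \<le> card Z \<and> (\<forall>w\<in>W. word_weight a w \<le> \<rho>) \<and>
        {x \<in> K. g x \<in> V} \<subseteq> (\<Union>w\<in>W. cyl w)"
    if \<rho>: "0 < \<rho>" "\<rho> < 1" and V: "bounded V" "diameter V \<le> \<rho>" for \<rho> V
  proof (cases "V = {}")
    case True
    thus ?thesis by (intro exI[of _ "{}"]) auto
  next
    case False
    then obtain v0 where v0: "v0 \<in> V" by blast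
    define W where "W = {w \<in> stopping_words \<rho>. g ` cyl w \<inter> V \<noteq> {}}"
    \<comment> \<open>The left endpoint in units of \<open>\<kappa> * \<rho>\<close>; distinct words differ by at least one unit.\<close>
    define h where "h w = (g (wmap w 0) - v0) / (\<kappa> * \<rho>)" for w
    have W: "w \<in> words" "word_weight a w \<le> \<rho>" "w \<in> stopping_words \<rho>" if "w \<in> W" for w
      using that by (auto simp: W_def stopping_words_def)
    have ge: "\<kappa> * \<rho> \<le> word_weight a w" if "w \<in> W" for w
      using stopping_words_weight_ge[OF W(3)[OF that]] \<rho> \<kappa> by auto
    have "\<lfloor>h w\<rfloor> \<in> Z" if w: "w \<in> W" for w
    proof -
      obtain x where x: "x \<in> cyl w" "g x \<in> V" using w by (auto simp: W_def)
      have "\<bar>g x - v0\<bar> \<le> \<rho>"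
        using diameter_bounded_bound[OF V(1) x(2) v0] V(2) by (simp add: dist_real_def)
      moreover have "g x \<in> {g (wmap w 0)..g (wmap w 0) + word_weight a w}"
        using g_cyl[OF W(1)[OF w]] x(1) by blast
      ultimately have "- (2 * \<rho>) \<le> g (wmap w 0) - v0" "g (wmap w 0) - v0 \<le> \<rho>"
        using W(2)[OF w] by auto
      moreover have "0 < \<kappa> * \<rho>" "- (2 / \<kappa>) * (\<kappa> * \<rho>) = - (2 * \<rho>)" "1 / \<kappa> * (\<kappa> * \<rho>) = \<rho>"
        using \<kappa>(1) \<rho>(1) by simp_all
      ultimately have "- (2 / \<kappa>) \<le> h w" "h w \<le> 1 / \<kappa>"
        unfolding h_def by (simp_all only: pos_le_divide_eq pos_divide_le_eq)
      thus ?thesis unfolding Z_def by (auto intro: floor_mono)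
    qed
    moreover have "inj_on (\<lambda>w. \<lfloor>h w\<rfloor>) W"
    proof (rule inj_onI, rule ccontr)
      fix v w assume vw: "v \<in> W" "w \<in> W" "\<lfloor>h v\<rfloor> = \<lfloor>h w\<rfloor>" "v \<noteq> w"
      have far: "\<kappa> * \<rho> \<le> g (wmap w' 0) - g (wmap v' 0)"
        if "v' \<in> W" "w' \<in> W" "wmap v' 1 \<le> wmap w' 0" for v' w'
      proof -
        have "g (wmap v' 1) \<le> g (wmap w' 0)"
          using that wmap_unit[OF W(1), of v' 1] wmap_unit[OF W(1), of w' 0] by (intro g_le) auto
        thus ?thesis using g_length[OF W(1)[OF that(1)]] ge[OF that(1)] by simp
      qed
      have "wmap v 1 \<le> wmap w 0 \<or> wmap w 1 \<le> wmap v 0"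
        using vw stopping_words_parallel[of v \<rho> w] W by (intro parallel_words_ordered) auto
      hence "\<kappa> * \<rho> \<le> \<bar>g (wmap w 0) - g (wmap v 0)\<bar>"
        using far[of v w] far[of w v] vw by auto
      moreover have "h w - h v = (g (wmap w 0) - g (wmap v 0)) / (\<kappa> * \<rho>)"
        unfolding h_def by (simp add: diff_divide_distrib[symmetric])
      ultimately have "1 \<le> \<bar>h w - h v\<bar>" using \<kappa> \<rho> by (simp add: abs_divide)
      thus False using vw(3) by linarith
    qed
    moreover have "finite Z" by (simp add: Z_def)
    ultimately have "finite W" "card W \<le> card Z"
      by (auto intro: inj_on_finite card_inj_on_le)
    moreover have "{x \<in> K. g x \<in> V} \<subseteq> (\<Union>w\<in>W. cyl w)"
    proof
      fix x assume x: "x \<in> {x \<in> K. g x \<in> V}"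
      obtain w where "w \<in> stopping_words \<rho>" "x \<in> cyl w"
        using stopping_words_cover[of x \<rho>] x \<rho> by auto
      thus "x \<in> (\<Union>w\<in>W. cyl w)" using x by (auto simp: W_def)
    qed
    ultimately show ?thesis using W by (intro exI[of _ W]) auto
  qed
  thus ?thesis by blast
qed

text \<open>Each covering set is replaced by boundedly many cylinders whose weight is at most slightly
  more than its diameter.\<close>

lemma word_null_if_hausdorff_null:
  assumes d: "0 < d" and A: "A \<subseteq> K" and null: "hausdorff_measure d (g ` A) = 0"
  shows "word_null a d A"
  unfolding word_null_def
proof (intro allI impI)
  fix \<eta> :: real assume \<eta>: "0 < \<eta>"
  obtain L :: nat where L: "\<forall>\<rho> V. 0 < \<rho> \<and> \<rho> < 1 \<and> bounded V \<and> diameter V \<le> \<rho> \<longrightarrow>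
     (\<exists>W\<subseteq>words. finite W \<and> card W \<le> L \<and> (\<forall>w\<in>W. word_weight a w \<le> \<rho>) \<and>
        {x \<in> K. g x \<in> V} \<subseteq> (\<Union>w\<in>W. cyl w))"
    using few_stopping_words_meet ..
  define \<epsilon> where "\<epsilon> = min (1/4) (\<eta> / (2 * (real L + 1)))"
  have \<epsilon>: "0 < \<epsilon>" "\<epsilon> \<le> 1/4" "real L * (2 * \<epsilon>) \<le> \<eta>"
  proof -
    show "0 < \<epsilon>" using \<eta> by (simp add: \<epsilon>_def)
    show "\<epsilon> \<le> 1/4" unfolding \<epsilon>_def by (rule min.cobounded1)
    have "real L * (2 * \<epsilon>) \<le> (2 * (real L + 1)) * \<epsilon>" using \<open>0 < \<epsilon>\<close> by (simp add: algebra_simps)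
    also have "\<dots> \<le> (2 * (real L + 1)) * (\<eta> / (2 * (real L + 1)))"
      by (intro mult_left_mono) (auto simp: \<epsilon>_def)
    also have "\<dots> = \<eta>" by simp
    finally show "real L * (2 * \<epsilon>) \<le> \<eta>" .
  qed
  obtain U where U: "g ` A \<subseteq> (\<Union>n. U n)" "\<And>n. bounded (U n)"
       "(\<Sum>n. ennreal (diameter (U n) powr d)) \<le> ennreal \<epsilon>"
    using null[unfolded hausdorff_measure_eq_0_iff[OF d], rule_format, OF \<epsilon>(1)]
    by (elim exE conjE) metis
  define D where "D n = diameter (U n) powr d" for n
  \<comment> \<open>The second summand keeps the scale positive when the covering set is a single point.\<close>
  define \<rho> where "\<rho> n = (D n + \<epsilon> * (1/2) ^ Suc n) powr (1 / d)" for n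
  have D0: "0 \<le> D n" for n by (simp add: D_def)
  have pos: "0 < D n + \<epsilon> * (1/2) ^ Suc n" for n
    using \<epsilon>(1) D0[of n] by (intro add_nonneg_pos) auto
  have \<rho>d: "\<rho> n powr d = D n + \<epsilon> * (1/2) ^ Suc n" for n
    using pos[of n] d by (simp add: \<rho>_def powr_powr)
  have "\<forall>n. \<exists>W\<subseteq>words. finite W \<and> card W \<le> L \<and> (\<forall>w\<in>W. word_weight a w \<le> \<rho> n) \<and>
        {x \<in> K. g x \<in> U n} \<subseteq> (\<Union>w\<in>W. cyl w)"
  proof (rule allI, rule L[rule_format], intro conjI)
    fix n
    show "0 < \<rho> n" using pos[of n] by (simp add: \<rho>_def)
    have "ennreal (D n) \<le> ennreal \<epsilon>"
      unfolding D_def by (rule order_trans[OF ennreal_le_suminf[of "\<lambda>n. ennreal (diameter (U n) powr d)"] U(3)])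
    hence "D n \<le> \<epsilon>" using \<epsilon>(1) by simp
    moreover have "\<epsilon> * (1/2) ^ Suc n \<le> \<epsilon> * 1" using \<epsilon>(1) by (intro mult_left_mono power_le_one) auto
    ultimately have "D n + \<epsilon> * (1/2) ^ Suc n < 1" using \<epsilon> by linarith
    hence "(D n + \<epsilon> * (1/2) ^ Suc n) powr (1 / d) < 1 powr (1 / d)"
      using d pos[of n] by (intro powr_less_mono2) auto
    thus "\<rho> n < 1" by (simp add: \<rho>_def)
    show "bounded (U n)" by (rule U(2))
    have "diameter (U n) powr d \<le> \<rho> n powr d"
      using \<epsilon>(1) unfolding \<rho>d by (simp add: D_def)
    thus "diameter (U n) \<le> \<rho> n"
      using powr_less_mono2[of d "\<rho> n" "diameter (U n)"] d \<open>0 < \<rho> n\<close> by linarith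
  qed
  from choice[OF this] obtain W where "\<forall>n. W n \<subseteq> words \<and> finite (W n) \<and> card (W n) \<le> L \<and>
      (\<forall>w\<in>W n. word_weight a w \<le> \<rho> n) \<and> {x \<in> K. g x \<in> U n} \<subseteq> (\<Union>w\<in>W n. cyl w)" ..
  hence W: "\<And>n. W n \<subseteq> words" "\<And>n. finite (W n)" "\<And>n. card (W n) \<le> L"
      "\<And>n w. w \<in> W n \<Longrightarrow> word_weight a w \<le> \<rho> n"
      "\<And>n. {x \<in> K. g x \<in> U n} \<subseteq> (\<Union>w\<in>W n. cyl w)" by simp_all
  have "word_content a d (W n) \<le> ennreal (real L) * (ennreal (D n) + ennreal (\<epsilon> * (1/2) ^ Suc n))" for n
  proof -
    have "(\<Sum>w\<in>W n. word_weight a w powr d) \<le> (\<Sum>w\<in>W n. \<rho> n powr d)"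
    proof (intro sum_mono powr_mono2)
      fix w assume w: "w \<in> W n"
      show "0 \<le> word_weight a w" using word_weight_pos[OF a subsetD[OF W(1) w]] by simp
      show "word_weight a w \<le> \<rho> n" by (rule W(4)[OF w])
    qed (use d in simp)
    also have "\<dots> \<le> real L * \<rho> n powr d"
      using W(3)[of n] by (simp add: mult_right_mono)
    finally show ?thesis
      unfolding word_content_finite[OF W(2)] \<rho>d
      using D0[of n] \<epsilon>(1) by (simp add: ennreal_plus[symmetric] ennreal_mult[symmetric] ennreal_leI del: ennreal_plus)
  qed
  hence "word_content a d (\<Union>n. W n) \<le>
     (\<Sum>n. ennreal (real L) * (ennreal (D n) + ennreal (\<epsilon> * (1/2) ^ Suc n)))"
    by (intro order_trans[OF word_content_UN] suminf_le summableI)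
  also have "\<dots> = ennreal (real L) * ((\<Sum>n. ennreal (D n)) + (\<Sum>n. ennreal (\<epsilon> * (1/2) ^ Suc n)))"
    by (simp only: ennreal_suminf_cmult suminf_add[OF summableI summableI, symmetric])
  also have "\<dots> \<le> ennreal (real L) * (ennreal \<epsilon> + ennreal \<epsilon>)"
  proof (intro mult_left_mono add_mono)
    show "(\<Sum>n. ennreal (D n)) \<le> ennreal \<epsilon>" unfolding D_def by (rule U(3))
    show "(\<Sum>n. ennreal (\<epsilon> * (1/2) ^ Suc n)) \<le> ennreal \<epsilon>"
      using suminf_geometric_half[of \<epsilon>] \<epsilon>(1) by (metis eq_refl less_imp_le)
  qed simp
  also have "\<dots> = ennreal (real L * (2 * \<epsilon>))"
    using \<epsilon>(1) by (simp add: ennreal_plus[symmetric] ennreal_mult[symmetric] del: ennreal_plus)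
  also have "\<dots> \<le> ennreal \<eta>" using \<epsilon>(3) by (rule ennreal_leI)
  finally have "word_content a d (\<Union>n. W n) \<le> ennreal \<eta>" .
  moreover have "A \<subseteq> (\<Union>w\<in>(\<Union>n. W n). cyl w)"
  proof
    fix x assume x: "x \<in> A"
    then obtain n where "g x \<in> U n" using U(1) by blast
    hence "x \<in> (\<Union>w\<in>W n. cyl w)" using x A W(5)[of n] by blast
    thus "x \<in> (\<Union>w\<in>(\<Union>n. W n). cyl w)" by blast
  qed
  moreover have "(\<Union>n. W n) \<subseteq> words" using W(1) by blast
  ultimately show "\<exists>W\<subseteq>words. A \<subseteq> (\<Union>w\<in>W. cyl w) \<and> word_content a d W \<le> ennreal \<eta>"
    by (intro exI[of _ "\<Union>n. W n"] conjI)
qed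

lemma hausdorff_null_iff_word_null:
  "0 < d \<Longrightarrow> A \<subseteq> K \<Longrightarrow> hausdorff_measure d (g ` A) = 0 \<longleftrightarrow> word_null a d A"
  using hausdorff_null_if_word_null word_null_if_hausdorff_null by blast

end

section \<open>Typical points\<close>

lemma ln_word_weight:
  assumes "weight_on m a" "w \<in> lists {1..m}"
  shows "ln (word_weight a w) = sum_list (map (\<lambda>i. ln (a i)) w)"
  using assms(2)
proof (induction w)
  case (Cons i w)
  have "0 < a i" "0 < word_weight a w"
    using Cons assms(1) word_weight_pos[OF assms(1), of w] by (auto simp: weight_on_def)
  thus ?case using Cons by (simp add: ln_mult)
qed simp

lemma word_weight_ge_power:
  assumes "weight_on m a" "w \<in> lists {1..m}" "0 < \<kappa>" "\<And>i. i \<in> {1..m} \<Longrightarrow> \<kappa> \<le> a i"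
  shows "\<kappa> ^ length w \<le> word_weight a w"
  using assms(2)
proof (induction w)
  case (Cons i w)
  thus ?case using assms(3) assms(4)[of i] by (auto intro!: mult_mono)
qed simp

text \<open>The distributive law: the words of length \<open>n\<close> index the terms of the expanded power.\<close>

lemma sum_word_weight:
  assumes "finite A"
  shows "(\<Sum>w | w \<in> lists A \<and> length w = n. word_weight c w) = (\<Sum>i\<in>A. c i) ^ n"
proof (induction n)
  case 0
  have "{w. w \<in> lists A \<and> length w = 0} = {[]}" by auto
  thus ?case by simp
next
  case (Suc n)
  let ?W = "\<lambda>n. {w. w \<in> lists A \<and> length w = n}"
  have eq: "?W (Suc n) = (\<lambda>(i, w). i # w) ` (A \<times> ?W n)"
    by (auto simp: length_Suc_conv image_iff)
  have "inj_on (\<lambda>(i, w). i # w) (A \<times> ?W n)" by (auto simp: inj_on_def)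
  hence "(\<Sum>w\<in>?W (Suc n). word_weight c w) = (\<Sum>(i, w)\<in>A \<times> ?W n. c i * word_weight c w)"
    unfolding eq by (subst sum.reindex) (auto simp: case_prod_unfold)
  also have "\<dots> = (\<Sum>i\<in>A. c i) * (\<Sum>w\<in>?W n. word_weight c w)"
    by (simp add: sum_product sum.cartesian_product)
  finally show ?case using Suc by simp
qed

text \<open>As a function of the exponent the sum starts at \<open>1\<close> with negative slope.\<close>

lemma chernoff_exponent:
  fixes q Y :: "nat \<Rightarrow> real"
  assumes "finite I" "(\<Sum>i\<in>I. q i) = 1" "(\<Sum>i\<in>I. q i * Y i) < 0"
  shows "\<exists>l>0. (\<Sum>i\<in>I. q i * exp (l * Y i)) < 1"
proof -
  have "((\<lambda>x. \<Sum>i\<in>I. q i * exp (x * Y i)) has_real_derivative (\<Sum>i\<in>I. q i * Y i)) (at 0)"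
    by (auto intro!: derivative_eq_intros simp: mult_ac)
  from DERIV_neg_dec_right[OF this assms(3)]
  obtain \<delta> where \<delta>: "\<delta> > 0"
     "\<And>h. h > 0 \<Longrightarrow> h < \<delta> \<Longrightarrow> (\<Sum>i\<in>I. q i * exp (h * Y i)) < 1"
    using assms(2) by auto
  show ?thesis using \<delta>(1) \<delta>(2)[of "\<delta> / 2"] by (intro exI[of _ "\<delta> / 2"]) auto
qed

context self_similar_set
begin

text \<open>Along the coding of \<open>x\<close> the weight decays like \<open>exp (- n * \<alpha>)\<close>. All words whose cylinder
  contains \<open>x\<close> are considered, so that the definition involves no choice of a code of \<open>x\<close>.\<close>

definition typical :: "(nat \<Rightarrow> real) \<Rightarrow> real \<Rightarrow> real \<Rightarrow> bool" where
  "typical a \<alpha> x \<longleftrightarrow> (\<forall>\<epsilon>>0. \<exists>N. \<forall>w\<in>words. N \<le> length w \<and> x \<in> cyl w \<longrightarrow>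
     \<bar>ln (word_weight a w) + real (length w) * \<alpha>\<bar> \<le> \<epsilon> * real (length w))"

text \<open>On the points where the decay rates are uniform from some length \<open>N\<close> on, the inequality
  between \<open>d * \<alpha>\<close> and \<open>e * \<beta>\<close> makes the \<open>e\<close>-th power of the weight \<open>b\<close> at most the \<open>d\<close>-th power
  of the weight \<open>a\<close>, for every word of length at least \<open>N\<close> whose cylinder contains such a point.
  Shorter words do not occur in a cover of small content. Countably many \<open>N\<close> exhaust the set.\<close>

lemma word_null_transfer:
  assumes a: "weight_on m a" and b: "weight_on m b" and d: "0 < d" and e: "0 < e"
    and de: "d * \<alpha> < e * \<beta>"
    and typical: "\<And>x. x \<in> A \<Longrightarrow> typical a \<alpha> x" "\<And>x. x \<in> A \<Longrightarrow> typical b \<beta> x"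
    and null: "word_null a d A"
  shows "word_null b e A"
proof -
  \<comment> \<open>Chosen such that the gap between the two rates is used up exactly: \<open>e * (\<beta> - \<epsilon>) = d * (\<alpha> + \<epsilon>)\<close>.\<close>
  define \<epsilon> where "\<epsilon> = (e * \<beta> - d * \<alpha>) / (d + e)"
  have \<epsilon>: "0 < \<epsilon>" using de d e by (simp add: \<epsilon>_def)
  have "(d + e) * \<epsilon> = e * \<beta> - d * \<alpha>" using d e by (simp add: \<epsilon>_def)
  hence bal: "e * (\<beta> - \<epsilon>) = d * (\<alpha> + \<epsilon>)" by (simp add: algebra_simps)
  define B where "B N = {x \<in> A. \<forall>w\<in>words. N \<le> length w \<and> x \<in> cyl w \<longrightarrow>
     \<bar>ln (word_weight a w) + real (length w) * \<alpha>\<bar> \<le> \<epsilon> * real (length w) \<and>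
     \<bar>ln (word_weight b w) + real (length w) * \<beta>\<bar> \<le> \<epsilon> * real (length w)}" for N
  have "A \<subseteq> (\<Union>N. B N)"
  proof
    fix x assume x: "x \<in> A"
    obtain N1 where N1: "\<And>w. w \<in> words \<Longrightarrow> N1 \<le> length w \<Longrightarrow> x \<in> cyl w \<Longrightarrow>
        \<bar>ln (word_weight a w) + real (length w) * \<alpha>\<bar> \<le> \<epsilon> * real (length w)"
      using typical(1)[OF x] \<epsilon> unfolding typical_def by blast
    obtain N2 where N2: "\<And>w. w \<in> words \<Longrightarrow> N2 \<le> length w \<Longrightarrow> x \<in> cyl w \<Longrightarrow>
        \<bar>ln (word_weight b w) + real (length w) * \<beta>\<bar> \<le> \<epsilon> * real (length w)"
      using typical(2)[OF x] \<epsilon> unfolding typical_def by blast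
    have "x \<in> B (max N1 N2)" using x N1 N2 by (simp add: B_def)
    thus "x \<in> (\<Union>N. B N)" by blast
  qed
  moreover have "word_null b e (B N)" for N
    unfolding word_null_def
  proof (intro allI impI)
    fix \<eta> :: real assume \<eta>: "0 < \<eta>"
    obtain \<kappa> where \<kappa>: "0 < \<kappa>" "\<kappa> \<le> 1" "\<And>i. i \<in> {1..m} \<Longrightarrow> \<kappa> \<le> a i"
      using weight_on_bounded_below[OF a] by auto
    \<comment> \<open>Words of length below \<open>N\<close> contribute more than this.\<close>
    define \<eta>' where "\<eta>' = min \<eta> ((\<kappa> ^ N) powr d / 2)"
    have \<eta>': "0 < \<eta>'" "\<eta>' \<le> \<eta>" "\<eta>' < (\<kappa> ^ N) powr d"
      using \<eta> \<kappa>(1) by (auto simp: \<eta>'_def min_less_iff_disj)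
    obtain W where W: "W \<subseteq> words" "A \<subseteq> (\<Union>w\<in>W. cyl w)" "word_content a d W \<le> ennreal \<eta>'"
      using word_nullD[OF null \<eta>'(1)] by auto
    define W' where "W' = {w \<in> W. cyl w \<inter> B N \<noteq> {}}"
    have "word_weight b w powr e \<le> word_weight a w powr d" if w: "w \<in> W'" for w
    proof -
      have ww: "w \<in> words" "w \<in> W" using w W(1) by (auto simp: W'_def)
      have pos: "0 < word_weight a w" "0 < word_weight b w"
        using word_weight_pos[OF a ww(1)] word_weight_pos[OF b ww(1)] by auto
      obtain x where x: "x \<in> cyl w" "x \<in> B N" using w by (auto simp: W'_def)
      have "N \<le> length w"
      proof (rule ccontr)
        assume "\<not> N \<le> length w"
        hence "\<kappa> ^ N \<le> \<kappa> ^ length w" using \<kappa> by (intro power_decreasing) auto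
        also have "\<dots> \<le> word_weight a w" using word_weight_ge_power[OF a ww(1) \<kappa>(1,3)] by simp
        finally have "(\<kappa> ^ N) powr d \<le> word_weight a w powr d"
          using \<kappa>(1) d by (intro powr_mono2) auto
        moreover have "ennreal (word_weight a w powr d) \<le> ennreal \<eta>'"
          using word_content_ge_member[OF ww(2)] W(3) by (rule order_trans)
        hence "word_weight a w powr d \<le> \<eta>'" using \<eta>'(1) by simp
        ultimately show False using \<eta>'(3) by simp
      qed
      hence close: "\<bar>ln (word_weight a w) + real (length w) * \<alpha>\<bar> \<le> \<epsilon> * real (length w)"
         "\<bar>ln (word_weight b w) + real (length w) * \<beta>\<bar> \<le> \<epsilon> * real (length w)"
        using x ww(1) by (auto simp: B_def)
      have "e * ln (word_weight b w) \<le> e * (- (real (length w) * (\<beta> - \<epsilon>)))"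
        using close(2) e by (intro mult_left_mono) (auto simp: algebra_simps abs_le_iff)
      also have "\<dots> = - (real (length w) * (e * (\<beta> - \<epsilon>)))" by (simp add: mult_ac)
      also have "\<dots> = d * (- (real (length w) * (\<alpha> + \<epsilon>)))" unfolding bal by (simp add: mult_ac)
      also have "\<dots> \<le> d * ln (word_weight a w)"
        using close(1) d by (intro mult_left_mono) (auto simp: algebra_simps abs_le_iff)
      finally show ?thesis using pos by (simp add: powr_def)
    qed
    hence "word_content b e W' \<le> word_content a d W'" by (rule word_content_le_transfer)
    also have "\<dots> \<le> word_content a d W" by (rule word_content_mono) (auto simp: W'_def)
    also have "\<dots> \<le> ennreal \<eta>'" by (rule W(3))
    also have "\<dots> \<le> ennreal \<eta>" using \<eta>'(2) by (rule ennreal_leI)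
    finally have "word_content b e W' \<le> ennreal \<eta>" .
    moreover have "W' \<subseteq> words" using W(1) by (auto simp: W'_def)
    moreover have "B N \<subseteq> (\<Union>w\<in>W'. cyl w)"
    proof
      fix x assume x: "x \<in> B N"
      hence "x \<in> A" by (simp add: B_def)
      then obtain w where "w \<in> W" "x \<in> cyl w" using W(2) by blast
      thus "x \<in> (\<Union>w\<in>W'. cyl w)" using x by (auto simp: W'_def)
    qed
    ultimately show "\<exists>W\<subseteq>words. B N \<subseteq> (\<Union>w\<in>W. cyl w) \<and> word_content b e W \<le> ennreal \<eta>"
      by (intro exI[of _ W'] conjI)
  qed
  hence "word_null b e (\<Union>N. B N)" by (rule word_null_UN)
  ultimately show ?thesis using word_null_subset by blast
qed

text \<open>Chernoff's bound, with the \<open>d\<close>-th powers of the weights as probabilities of the letters: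
  the words of length \<open>n\<close> along which \<open>Y\<close> has a nonnegative sum have total probability at most
  \<open>\<theta> ^ n\<close> for some \<open>\<theta> < 1\<close>. The tails of the geometric series bound the content of a cover. The
  probability of a word is its contribution to the content, which is why a bound for a
  probability is directly a bound for a cover.\<close>

lemma word_null_large_deviation:
  assumes a: "weight_on m a" and q: "(\<Sum>i=1..m. a i powr d) = 1"
    and Y: "(\<Sum>i=1..m. a i powr d * Y i) < 0"
  shows "word_null a d {x. \<forall>N. \<exists>w\<in>words. N \<le> length w \<and> x \<in> cyl w \<and> 0 \<le> sum_list (map Y w)}"
    (is "word_null a d ?B")
  unfolding word_null_def
proof (intro allI impI)
  fix \<eta> :: real assume \<eta>: "0 < \<eta>"
  obtain l where l: "0 < l" "(\<Sum>i=1..m. a i powr d * exp (l * Y i)) < 1"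
    using chernoff_exponent[OF _ q Y] by auto
  define c where "c i = a i powr d * exp (l * Y i)" for i
  define \<theta> where "\<theta> = (\<Sum>i=1..m. c i)"
  have \<theta>: "0 \<le> \<theta>" "\<theta> < 1" using l(2) by (auto simp: \<theta>_def c_def intro!: sum_nonneg)
  have c: "word_weight c w = word_weight a w powr d * exp (l * sum_list (map Y w))"
    if "w \<in> words" for w
    using that
  proof (induction w)
    case (Cons i w)
    have "0 < a i" "0 < word_weight a w"
      using Cons a word_weight_pos[OF a, of w] by (auto simp: weight_on_def)
    thus ?case using Cons by (simp add: c_def powr_mult exp_add ring_distribs)
  qed simp
  have c_pos: "0 \<le> word_weight c w" if "w \<in> words" for w
    using that by (simp add: c)
  define W where "W n = {w. (w \<in> words \<and> length w = n) \<and> 0 \<le> sum_list (map Y w)}" for n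
  have fin: "finite {w. w \<in> words \<and> length w = n}" for n
    using finite_lists_length_eq[of "{1..m}" n] by (simp add: lists_eq_set)
  have contentW: "word_content a d (W n) \<le> ennreal (\<theta> ^ n)" for n
  proof -
    have "(\<Sum>w\<in>W n. word_weight a w powr d) \<le> (\<Sum>w\<in>W n. word_weight c w)"
    proof (rule sum_mono)
      fix w assume w: "w \<in> W n"
      have "1 \<le> exp (l * sum_list (map Y w))" using w l(1) by (simp add: W_def)
      hence "word_weight a w powr d * 1 \<le> word_weight a w powr d * exp (l * sum_list (map Y w))"
        by (intro mult_left_mono) auto
      thus "word_weight a w powr d \<le> word_weight c w" using w by (simp add: W_def c)
    qed
    also have "\<dots> \<le> (\<Sum>w | w \<in> words \<and> length w = n. word_weight c w)"
      by (intro sum_mono2 fin) (auto simp: W_def intro: c_pos)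
    also have "\<dots> = \<theta> ^ n" unfolding \<theta>_def by (rule sum_word_weight) simp
    finally have "(\<Sum>w\<in>W n. word_weight a w powr d) \<le> \<theta> ^ n" .
    moreover have "finite (W n)" by (rule finite_subset[OF _ fin[of n]]) (auto simp: W_def)
    ultimately show ?thesis by (simp add: word_content_finite ennreal_leI)
  qed
  have "0 < \<eta> * (1 - \<theta>)" using \<eta> \<theta> by simp
  then obtain N where N: "\<theta> ^ N < \<eta> * (1 - \<theta>)" using real_arch_pow_inv[OF _ \<theta>(2)] by blast
  have "word_content a d (\<Union>n. W (n + N)) \<le> (\<Sum>n. ennreal (\<theta> ^ (n + N)))"
    by (intro order_trans[OF word_content_UN] suminf_le contentW summableI)
  also have "\<dots> = ennreal (\<theta> ^ N * (1 / (1 - \<theta>)))"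
  proof (rule suminf_ennreal_eq)
    have "(\<lambda>n. \<theta> ^ N * \<theta> ^ n) sums (\<theta> ^ N * (1 / (1 - \<theta>)))"
      using \<theta> by (intro sums_mult geometric_sums) auto
    thus "(\<lambda>n. \<theta> ^ (n + N)) sums (\<theta> ^ N * (1 / (1 - \<theta>)))" by (simp add: power_add mult.commute)
  qed (use \<theta> in auto)
  also have "\<dots> \<le> ennreal \<eta>" using N \<theta> by (intro ennreal_leI) (simp add: divide_le_eq)
  finally have "word_content a d (\<Union>n. W (n + N)) \<le> ennreal \<eta>" .
  moreover have "?B \<subseteq> (\<Union>w\<in>(\<Union>n. W (n + N)). cyl w)"
  proof
    fix x assume "x \<in> ?B"
    then obtain w where w: "w \<in> words" "N \<le> length w" "x \<in> cyl w" "0 \<le> sum_list (map Y w)" by blast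
    hence "w \<in> W ((length w - N) + N)" by (simp add: W_def)
    thus "x \<in> (\<Union>w\<in>(\<Union>n. W (n + N)). cyl w)" using w(3) by blast
  qed
  moreover have "(\<Union>n. W (n + N)) \<subseteq> words" by (auto simp: W_def)
  ultimately show "\<exists>W\<subseteq>words. ?B \<subseteq> (\<Union>w\<in>W. cyl w) \<and> word_content a d W \<le> ennreal \<eta>"
    by (intro exI[of _ "\<Union>n. W (n + N)"] conjI)
qed

lemma sum_list_map_affine:
  fixes f :: "nat \<Rightarrow> real"
  shows "sum_list (map (\<lambda>i. c * f i + k) w) = c * sum_list (map f w) + real (length w) * k"
  by (induction w) (simp_all add: algebra_simps)

text \<open>The strong law of large numbers: infinitely many deviations by more than \<open>1 / Suc k\<close>,
  upwards or downwards, are large deviations of a letter function with negative mean.\<close>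

lemma word_null_nontypical:
  assumes a: "weight_on m a" and q: "(\<Sum>i=1..m. a i powr d) = 1" and b: "weight_on m b"
    and \<beta>: "\<beta> = - (\<Sum>i=1..m. a i powr d * ln (b i))"
  shows "word_null a d {x. \<not> typical b \<beta> x}"
proof -
  define B where "B c k = {x. \<forall>N. \<exists>w\<in>words. N \<le> length w \<and> x \<in> cyl w \<and>
     0 \<le> sum_list (map (\<lambda>i. c * ln (b i) + (c * \<beta> - 1 / real (Suc k))) w)}" for c :: real and k :: nat
  have "word_null a d (B c k)" for c k
    unfolding B_def
  proof (rule word_null_large_deviation[OF a q])
    have "(\<Sum>i=1..m. a i powr d * (c * ln (b i) + (c * \<beta> - 1 / real (Suc k)))) =
       c * (\<Sum>i=1..m. a i powr d * ln (b i)) + (c * \<beta> - 1 / real (Suc k)) * (\<Sum>i=1..m. a i powr d)"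
      by (simp add: ring_distribs sum.distrib sum_distrib_left mult_ac sum_subtractf)
    also have "\<dots> = - 1 / real (Suc k)" unfolding q \<beta> by simp
    also have "\<dots> < 0" by simp
    finally show "(\<Sum>i=1..m. a i powr d * (c * ln (b i) + (c * \<beta> - 1 / real (Suc k)))) < 0" .
  qed
  hence "word_null a d (\<Union>k. B 1 k \<union> B (-1) k)" by (intro word_null_UN word_null_Un)
  moreover have "{x. \<not> typical b \<beta> x} \<subseteq> (\<Union>k. B 1 k \<union> B (-1) k)"
  proof
    fix x assume "x \<in> {x. \<not> typical b \<beta> x}"
    then obtain \<epsilon> where \<epsilon>: "0 < \<epsilon>" and bad: "\<And>N. \<exists>w\<in>words. N \<le> length w \<and> x \<in> cyl w \<and>
        \<epsilon> * real (length w) < \<bar>ln (word_weight b w) + real (length w) * \<beta>\<bar>"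
      unfolding typical_def by (auto simp: not_le)
    obtain k where k: "1 / real (Suc k) < \<epsilon>" using \<epsilon> nat_approx_posE by (metis inverse_eq_divide)
    define Q where "Q c w \<longleftrightarrow> 0 \<le> sum_list (map (\<lambda>i. c * ln (b i) + (c * \<beta> - 1 / real (Suc k))) w)"
      for c :: real and w
    have Q: "Q 1 w \<or> Q (-1) w"
      if w: "w \<in> words" "\<epsilon> * real (length w) < \<bar>ln (word_weight b w) + real (length w) * \<beta>\<bar>" for w
    proof -
      have "real (length w) * (1 / real (Suc k)) \<le> real (length w) * \<epsilon>"
        using k by (intro mult_left_mono) auto
      hence "real (length w) * (1 / real (Suc k)) \<le> \<bar>ln (word_weight b w) + real (length w) * \<beta>\<bar>"
        using w(2) by (simp add: mult.commute)
      thus ?thesis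
        unfolding Q_def sum_list_map_affine ln_word_weight[OF b w(1)]
        by (simp add: right_diff_distrib abs_if split: if_splits)
    qed
    \<comment> \<open>If the deviations of each sign stopped at some length, all would stop at the larger one.\<close>
    have "x \<in> B 1 k \<union> B (-1) k"
    proof (rule ccontr)
      assume "x \<notin> B 1 k \<union> B (-1) k"
      then obtain N1 N2 where
        N: "\<And>w. w \<in> words \<Longrightarrow> N1 \<le> length w \<Longrightarrow> x \<in> cyl w \<Longrightarrow> \<not> Q 1 w"
           "\<And>w. w \<in> words \<Longrightarrow> N2 \<le> length w \<Longrightarrow> x \<in> cyl w \<Longrightarrow> \<not> Q (-1) w"
        unfolding B_def Q_def by blast
      obtain w where "w \<in> words" "max N1 N2 \<le> length w" "x \<in> cyl w"
         "\<epsilon> * real (length w) < \<bar>ln (word_weight b w) + real (length w) * \<beta>\<bar>"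
        using bad[of "max N1 N2"] by blast
      thus False using Q[of w] N[of w] by auto
    qed
    thus "x \<in> (\<Union>k. B 1 k \<union> B (-1) k)" by blast
  qed
  ultimately show ?thesis using word_null_subset by blast
qed

end

section \<open>The distribution function of the self-similar measure\<close>

locale self_similar_measure = self_similar_set +
  fixes p :: "nat \<Rightarrow> real" and \<mu> :: "real measure" and F :: "real \<Rightarrow> real"
  assumes p: "\<And>i. i \<in> {1..m} \<Longrightarrow> 0 < p i" "(\<Sum>i=1..m. p i) = 1"
    and \<mu>: "prob_space \<mu>" "sets \<mu> = sets borel"
      "\<And>B. B \<in> sets borel \<Longrightarrow>
         measure \<mu> B = (\<Sum>i=1..m. p i * measure \<mu> (sim_map r t i -` B))"
    and F: "\<And>x. F x = measure \<mu> {0..x}"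
begin

lemma weight_on_p: "weight_on m p"
  unfolding weight_on_def
proof (intro ballI conjI)
  fix i assume i: "i \<in> {1..m}"
  show "0 < p i" by (rule p(1)[OF i])
  define j where "j = (if i = 1 then 2 else 1 :: nat)"
  have j: "j \<in> {1..m}" "j \<noteq> i" using m by (auto simp: j_def)
  have "p i + p j = sum p {i, j}" using j by simp
  also have "\<dots> \<le> sum p {1..m}" using i j p(1) by (intro sum_mono2) (auto simp: less_imp_le)
  finally show "p i < 1" using p(1)[OF j(1)] p(2) by simp
qed

lemma sim_map_vimage_Icc:
  assumes "i \<in> {1..m}"
  shows "sim_map r t i -` {c..d} = {(c - t i) / r i..(d - t i) / r i}"
  using r[OF assms] by (auto simp: sim_map_def field_simps)

lemma mu_mono: "A \<subseteq> B \<Longrightarrow> B \<in> sets borel \<Longrightarrow> measure \<mu> A \<le> measure \<mu> B"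
  using \<mu>(1,2) by (intro finite_measure.finite_measure_mono prob_space.finite_measure) auto

lemma mu_le_1: "measure \<mu> B \<le> 1"
  using \<mu>(1) by (rule prob_space.prob_le_1)

lemma mu_UNIV: "measure \<mu> UNIV = 1"
  using \<mu>(1,2) prob_space.prob_space[of \<mu>] sets_eq_imp_space_eq[OF \<mu>(2)] by simp

text \<open>The inverse maps expand: mass outside \<open>{-c..1 + c}\<close> comes from outside
  \<open>{-c / \<rho>..1 + c / \<rho>}\<close>, where \<open>\<rho> < 1\<close> bounds the ratios. Iteration pushes this mass to
  infinity, so that there is none for any \<open>c > 0\<close>.\<close>

lemma mu_unit_interval: "measure \<mu> {0..1} = 1"
proof -
  interpret prob_space \<mu> by (rule \<mu>(1))
  obtain \<rho> where \<rho>: "0 < \<rho>" "\<rho> < 1" "\<And>i. i \<in> {1..m} \<Longrightarrow> r i \<le> \<rho>"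
  proof -
    obtain \<rho> where "0 < \<rho>" "\<rho> < 1" "\<forall>w\<in>words. word_weight r w \<le> \<rho> ^ length w"
      using word_weight_geometric[OF weight_on_r] by auto
    moreover have "r i \<le> \<rho>" if "i \<in> {1..m}" for i
      using \<open>\<forall>w\<in>words. _ w\<close>[rule_format, of "[i]"] that by simp
    ultimately show ?thesis using that by blast
  qed
  define G where "G c = measure \<mu> {-c..1 + c}" for c
  have step: "G (c / \<rho>) \<le> G c" if c: "0 \<le> c" for c
  proof -
    have "G (c / \<rho>) = (\<Sum>i=1..m. p i * G (c / \<rho>))"
      using p(2) by (simp add: sum_distrib_right[symmetric])
    also have "\<dots> \<le> (\<Sum>i=1..m. p i * measure \<mu> (sim_map r t i -` {-c..1 + c}))"
    proof (intro sum_mono mult_left_mono)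
      fix i assume i: "i \<in> {1..m}"
      have "c / \<rho> \<le> c / r i" using c r[OF i] \<rho>(3)[OF i] by (intro divide_left_mono) auto
      moreover have "0 \<le> t i / r i" "1 \<le> (1 - t i) / r i"
        using interval_bounds[OF i] r[OF i] by auto
      moreover have "(- c - t i) / r i = - (c / r i) - t i / r i"
        "(1 + c - t i) / r i = (1 - t i) / r i + c / r i"
        by (simp_all add: diff_divide_distrib add_divide_distrib)
      ultimately have "{- (c / \<rho>)..1 + c / \<rho>} \<subseteq> sim_map r t i -` {-c..1 + c}"
        unfolding sim_map_vimage_Icc[OF i] by auto
      thus "G (c / \<rho>) \<le> measure \<mu> (sim_map r t i -` {-c..1 + c})"
        unfolding G_def sim_map_vimage_Icc[OF i] by (intro mu_mono) auto
    qed (use p(1) in \<open>auto simp: less_imp_le\<close>)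
    also have "\<dots> = G c" unfolding G_def by (rule \<mu>(3)[symmetric]) simp
    finally show ?thesis .
  qed
  have G1: "G c = 1" if c: "0 < c" for c
  proof (rule antisym)
    show "G c \<le> 1" unfolding G_def by (rule prob_le_1)
    have iter: "G (c / \<rho> ^ n) \<le> G c" for n
    proof (induction n)
      case (Suc n)
      have "G (c / \<rho> ^ Suc n) = G ((c / \<rho> ^ n) / \<rho>)" by (simp add: mult.commute)
      also have "\<dots> \<le> G (c / \<rho> ^ n)" using c \<rho>(1) by (intro step) auto
      finally show ?case using Suc by simp
    qed simp
    have "incseq (\<lambda>n. {- (c / \<rho> ^ n)..1 + c / \<rho> ^ n})"
    proof (rule incseq_SucI)
      fix n
      have "\<rho> ^ Suc n \<le> \<rho> ^ n" using \<rho> by (intro power_decreasing) auto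
      hence "c / \<rho> ^ n \<le> c / \<rho> ^ Suc n" using c \<rho>(1) by (intro divide_left_mono) auto
      thus "{- (c / \<rho> ^ n)..1 + c / \<rho> ^ n} \<subseteq> {- (c / \<rho> ^ Suc n)..1 + c / \<rho> ^ Suc n}" by auto
    qed
    hence "(\<lambda>n. measure \<mu> {- (c / \<rho> ^ n)..1 + c / \<rho> ^ n})
        \<longlonglongrightarrow> measure \<mu> (\<Union>n. {- (c / \<rho> ^ n)..1 + c / \<rho> ^ n})"
      by (intro finite_Lim_measure_incseq) (auto simp: \<mu>(2))
    moreover have "(\<Union>n. {- (c / \<rho> ^ n)..1 + c / \<rho> ^ n}) = UNIV"
    proof (intro set_eqI iffI UNIV_I)
      fix x :: real
      have "0 < c / (\<bar>x\<bar> + 1)" using c by simp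
      then obtain n where n: "\<rho> ^ n < c / (\<bar>x\<bar> + 1)" using real_arch_pow_inv[OF _ \<rho>(2)] by blast
      hence "\<bar>x\<bar> + 1 \<le> c / \<rho> ^ n" using \<rho>(1) c by (simp add: field_simps)
      hence "x \<in> {- (c / \<rho> ^ n)..1 + c / \<rho> ^ n}" by auto
      thus "x \<in> (\<Union>n. {- (c / \<rho> ^ n)..1 + c / \<rho> ^ n})" by blast
    qed
    ultimately have "(\<lambda>n. G (c / \<rho> ^ n)) \<longlonglongrightarrow> 1" unfolding G_def by (simp add: mu_UNIV)
    thus "1 \<le> G c" by (rule LIMSEQ_le_const2) (use iter in auto)
  qed
  have "decseq (\<lambda>n. {- inverse (real (Suc n))..1 + inverse (real (Suc n))})"
    by (intro decseq_SucI) (auto simp: field_simps)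
  hence "(\<lambda>n. measure \<mu> {- inverse (real (Suc n))..1 + inverse (real (Suc n))})
      \<longlonglongrightarrow> measure \<mu> (\<Inter>n. {- inverse (real (Suc n))..1 + inverse (real (Suc n))})"
    by (intro finite_Lim_measure_decseq) (auto simp: \<mu>(2))
  moreover have "measure \<mu> {- inverse (real (Suc n))..1 + inverse (real (Suc n))} = 1" for n
    using G1[of "inverse (real (Suc n))"] by (simp add: G_def)
  moreover have "(\<Inter>n. {- inverse (real (Suc n))..1 + inverse (real (Suc n))}) = {0..1::real}"
  proof (intro set_eqI iffI)
    fix x :: real assume "x \<in> (\<Inter>n. {- inverse (real (Suc n))..1 + inverse (real (Suc n))})"
    hence x: "- inverse (real (Suc n)) \<le> x" "x \<le> 1 + inverse (real (Suc n))" for n by auto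
    have "0 \<le> x"
    proof (rule ccontr)
      assume "\<not> 0 \<le> x"
      then obtain n where "inverse (real (Suc n)) < - x" using reals_Archimedean[of "- x"] by auto
      thus False using x(1)[of n] by linarith
    qed
    moreover have "x \<le> 1"
    proof (rule ccontr)
      assume "\<not> x \<le> 1"
      then obtain n where "inverse (real (Suc n)) < x - 1" using reals_Archimedean[of "x - 1"] by auto
      thus False using x(2)[of n] by linarith
    qed
    ultimately show "x \<in> {0..1}" by simp
  next
    fix x :: real assume x: "x \<in> {0..1}"
    have "0 < inverse (real (Suc n))" for n by simp
    hence "- inverse (real (Suc n)) \<le> x \<and> x \<le> 1 + inverse (real (Suc n))" for n
      using x by (smt (verit) atLeastAtMost_iff)
    thus "x \<in> (\<Inter>n. {- inverse (real (Suc n))..1 + inverse (real (Suc n))})" by auto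
  qed
  ultimately show ?thesis by (simp add: LIMSEQ_const_iff)
qed

lemma mu_Icc_nonpos: "c \<le> 0 \<Longrightarrow> measure \<mu> {c..x} = F x"
proof -
  assume c: "c \<le> 0"
  interpret prob_space \<mu> by (rule \<mu>(1))
  have "AE y in \<mu>. y \<in> {0..1}"
    using mu_unit_interval by (intro AE_prob_1) simp
  thus ?thesis unfolding F
    by (intro finite_measure_eq_AE) (use c in \<open>auto simp: \<mu>(2) elim!: eventually_mono\<close>)
qed

lemma F_ge_1: "1 \<le> x \<Longrightarrow> F x = 1"
  using mu_mono[of "{0..1}" "{0..x}"] mu_unit_interval mu_le_1[of "{0..x}"]
  by (simp add: F)

lemma F_neg: "x < 0 \<Longrightarrow> F x = 0"
  by (simp add: F)

text \<open>The intervals to the left of the \<open>i\<close>-th one contribute their full mass, those to its right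
  nothing. In particular the distribution function rises by \<open>p i\<close> across the \<open>i\<close>-th interval.\<close>

lemma F_sim_map:
  assumes i: "i \<in> {1..m}" and x: "x \<in> {0..1}"
  shows "F (sim_map r t i x) = (\<Sum>j=1..<i. p j) + p i * F x"
proof -
  let ?y = "sim_map r t i x"
  have y: "t i \<le> ?y" "?y \<le> r i + t i"
    using x r[OF i] by (auto simp: sim_map_def mult_le_cancel_left1)
  have "F ?y = (\<Sum>j=1..m. p j * measure \<mu> (sim_map r t j -` {0..?y}))"
    unfolding F by (rule \<mu>(3)) simp
  also have "\<dots> = (\<Sum>j=1..m. p j * F ((?y - t j) / r j))"
  proof (rule sum.cong[OF refl])
    fix j assume j: "j \<in> {1..m}"
    have "(0 - t j) / r j \<le> 0"
      using interval_bounds(1)[OF j] r[OF j] by (simp add: divide_nonpos_pos)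
    thus "p j * measure \<mu> (sim_map r t j -` {0..?y}) = p j * F ((?y - t j) / r j)"
      by (simp only: sim_map_vimage_Icc[OF j] mu_Icc_nonpos)
  qed
  also have "\<dots> = (\<Sum>j=1..m. (if j < i then p j else 0) + (if j = i then p i * F x else 0))"
  proof (rule sum.cong[OF refl])
    fix j assume j: "j \<in> {1..m}"
    consider "j < i" | "j = i" | "i < j" by linarith
    thus "p j * F ((?y - t j) / r j) = (if j < i then p j else 0) + (if j = i then p i * F x else 0)"
    proof cases
      case 1
      hence "1 \<le> (?y - t j) / r j" using intervals_ordered[OF j i] y(1) r[OF j] by simp
      thus ?thesis using 1 F_ge_1 by simp
    next
      case 2
      have "(?y - t i) / r i = x" using r[OF i] by (simp add: sim_map_def)
      thus ?thesis using 2 by simp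
    next
      case 3
      hence "(?y - t j) / r j < 0"
        using intervals_ordered[OF i j] y(2) r[OF j] by (simp add: divide_neg_pos)
      thus ?thesis using 3 F_neg by simp
    qed
  qed
  also have "\<dots> = (\<Sum>j=1..m. if j < i then p j else 0) + p i * F x"
    using i by (simp add: sum.distrib)
  also have "(\<Sum>j=1..m. if j < i then p j else 0) = (\<Sum>j=1..<i. p j)"
    using i by (intro sum.mono_neutral_cong_right) auto
  finally show ?thesis .
qed

lemma F_0: "F 0 = 0"
proof -
  have "F 0 = p 1 * F 0"
    using F_sim_map[of 1 0] t(1) m by (simp add: sim_map_def)
  moreover have "p 1 < 1" using weight_on_p m by (simp add: weight_on_def)
  ultimately show ?thesis by simp
qed

lemma F_word_map_diff:
  assumes "w \<in> words" "x \<in> {0..1}" "y \<in> {0..1}"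
  shows "F (wmap w y) - F (wmap w x) = word_weight p w * (F y - F x)"
  using assms(1)
proof (induction w)
  case (Cons i w)
  hence i: "i \<in> {1..m}" "w \<in> words" by auto
  have "F (wmap (i # w) y) - F (wmap (i # w) x) = p i * (F (wmap w y) - F (wmap w x))"
    using F_sim_map[OF i(1) wmap_unit[OF i(2) assms(2)]] F_sim_map[OF i(1) wmap_unit[OF i(2) assms(3)]]
    by (simp add: right_diff_distrib)
  thus ?case using Cons i by simp
qed simp

sublocale length: coordinate m r t K r "\<lambda>x. x"
  by unfold_locales (auto simp: weight_on_r wmap_length intro: mono_onI)

sublocale mass: coordinate m r t K p F
proof unfold_locales
  show "weight_on m p" by (rule weight_on_p)
  show "mono_on {0..1} F" unfolding F by (intro mono_onI mu_mono) auto
  show "F (wmap w 1) - F (wmap w 0) = word_weight p w" if "w \<in> words" for w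
    using F_word_map_diff[OF that, of 0 1] F_0 F_ge_1[of 1] by simp
qed

text \<open>Both inequalities are the same argument: null sets are turned into null covers by
  cylinders in one coordinate, transferred to the other weight, and turned back.\<close>

lemma hausdorff_dim_F_image:
  assumes A: "A \<subseteq> K" and \<alpha>: "0 < \<alpha>" and \<beta>: "0 < \<beta>"
    and typical: "\<And>x. x \<in> A \<Longrightarrow> typical r \<alpha> x" "\<And>x. x \<in> A \<Longrightarrow> typical p \<beta> x"
  shows "hausdorff_dim (F ` A) = ennreal (\<alpha> / \<beta>) * hausdorff_dim A"
proof (rule antisym)
  show "hausdorff_dim (F ` A) \<le> ennreal (\<alpha> / \<beta>) * hausdorff_dim A"
  proof (rule hausdorff_dim_le_mult)
    fix d e assume d: "0 < d" and de: "d * (\<alpha> / \<beta>) < e" and null: "hausdorff_measure d A = 0"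
    have e: "0 < e" using de d \<alpha> \<beta> by (meson divide_pos_pos less_trans mult_pos_pos)
    have "word_null r d A" using length.hausdorff_null_iff_word_null[OF d A] null by simp
    hence "word_null p e A"
      using de \<beta> by (intro word_null_transfer[OF weight_on_r weight_on_p d e _ typical])
        (auto simp: field_simps)
    thus "hausdorff_measure e (F ` A) = 0" using mass.hausdorff_null_iff_word_null[OF e A] by simp
  qed (use \<alpha> \<beta> in auto)
  have "hausdorff_dim A \<le> ennreal (\<beta> / \<alpha>) * hausdorff_dim (F ` A)"
  proof (rule hausdorff_dim_le_mult)
    fix d e assume d: "0 < d" and de: "d * (\<beta> / \<alpha>) < e" and null: "hausdorff_measure d (F ` A) = 0"
    have e: "0 < e" using de d \<alpha> \<beta> by (meson divide_pos_pos less_trans mult_pos_pos)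
    have "word_null p d A" using mass.hausdorff_null_iff_word_null[OF d A] null by simp
    hence "word_null r e A"
      using de \<alpha> by (intro word_null_transfer[OF weight_on_p weight_on_r d e _ typical(2,1)])
        (auto simp: field_simps)
    thus "hausdorff_measure e A = 0" using length.hausdorff_null_iff_word_null[OF e A] by simp
  qed (use \<alpha> \<beta> in auto)
  hence "ennreal (\<alpha> / \<beta>) * hausdorff_dim A
     \<le> ennreal (\<alpha> / \<beta>) * (ennreal (\<beta> / \<alpha>) * hausdorff_dim (F ` A))"
    by (rule mult_left_mono) simp
  also have "\<dots> = ennreal ((\<alpha> / \<beta>) * (\<beta> / \<alpha>)) * hausdorff_dim (F ` A)"
    using \<alpha> \<beta> by (subst ennreal_mult) (simp_all add: mult.assoc)
  also have "\<dots> = hausdorff_dim (F ` A)" using \<alpha> \<beta> by simp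
  finally show "ennreal (\<alpha> / \<beta>) * hausdorff_dim A \<le> hausdorff_dim (F ` A)" .
qed

end

section \<open>The dimension of images of typical points\<close>

theorem theorem2p2:
  fixes m :: nat and r t p q :: "nat \<Rightarrow> real" and s :: real
    and K :: "real set" and \<mu> :: "real measure" and F :: "real \<Rightarrow> real"
  assumes m: "2 \<le> m"
    and r: "\<And>i. i \<in> {1..m} \<Longrightarrow> 0 < r i \<and> r i < 1"
    and t: "t 1 = 0" "strict_mono_on {1..m} t" "t m < r m + t m" "r m + t m = 1"
    and disjoint: "disjoint_family_on (\<lambda>i. sim_map r t i ` {0..1}) {1..m}"
    and K: "compact K" "K \<noteq> {}" "K = (\<Union>i\<in>{1..m}. sim_map r t i ` K)"
    and p: "\<And>i. i \<in> {1..m} \<Longrightarrow> 0 < p i" "(\<Sum>i=1..m. p i) = 1"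
    and \<mu>: "prob_space \<mu>" "sets \<mu> = sets borel"
      "\<And>B. B \<in> sets borel \<Longrightarrow>
         measure \<mu> B = (\<Sum>i=1..m. p i * measure \<mu> (sim_map r t i -` B))"
    and F: "\<And>x. F x = measure \<mu> {0..x}"
    and s: "0 < s" "(\<Sum>i=1..m. r i powr s) = 1"
    and q: "\<And>i. i \<in> {1..m} \<Longrightarrow> q i = r i powr s"
  shows "\<exists>M. M \<subseteq> K - gap_endpoints K \<and> hausdorff_measure s (K - M) = 0 \<and>
    (\<forall>A. A \<subseteq> M \<longrightarrow>
       hausdorff_dim (F ` A)
         = ennreal (lyapunov_exponent m r q / cross_entropy m q p) * hausdorff_dim A)"
proof -
  interpret self_similar_measure m r t K p \<mu> F
    by (intro self_similar_measure.intro self_similar_set.intro self_similar_measure_axioms.intro)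
      (fact m r t(1,2,4) disjoint K p \<mu> F)+
  define lyap ent where "lyap = lyapunov_exponent m r q" and "ent = cross_entropy m q p"
  have lyap: "lyap = - (\<Sum>i=1..m. r i powr s * ln (r i))" and ent: "ent = - (\<Sum>i=1..m. r i powr s * ln (p i))"
    unfolding lyap_def ent_def lyapunov_exponent_def cross_entropy_def by (simp_all add: q)
  have pos: "0 < - (\<Sum>i=1..m. r i powr s * ln (b i))" if b: "weight_on m b" for b
    unfolding sum_negf[symmetric]
  proof (rule sum_pos)
    fix i assume i: "i \<in> {1..m}"
    have "ln (b i) < 0" "0 < r i powr s" using b i r[OF i] by (auto simp: weight_on_def)
    thus "0 < - (r i powr s * ln (b i))" by (simp add: mult_pos_neg)
  qed (use m in auto)
  have pos: "0 < lyap" "0 < ent"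
    unfolding lyap ent by (intro pos weight_on_r weight_on_p)+
  define M where "M = {x \<in> K - gap_endpoints K. typical r lyap x \<and> typical p ent x}"
  have "word_null r s (K \<inter> gap_endpoints K)"
    using countable_gap_endpoints[of K] K(1) s(1)
    by (intro word_null_countable weight_on_r) (auto intro: compact_imp_closed countable_subset)
  moreover have "word_null r s {x. \<not> typical r lyap x}" "word_null r s {x. \<not> typical p ent x}"
    by (intro word_null_nontypical weight_on_r weight_on_p s(2) lyap ent)+
  ultimately have "word_null r s
      ((K \<inter> gap_endpoints K) \<union> ({x. \<not> typical r lyap x} \<union> {x. \<not> typical p ent x}))"
    by (intro word_null_Un)
  hence "word_null r s (K - M)" by (rule word_null_subset) (auto simp: M_def)
  hence "hausdorff_measure s (K - M) = 0"
    using length.hausdorff_null_iff_word_null[OF s(1), of "K - M"] by simp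
  moreover have "hausdorff_dim (F ` A) = ennreal (lyap / ent) * hausdorff_dim A" if "A \<subseteq> M" for A
    using that by (intro hausdorff_dim_F_image pos) (auto simp: M_def)
  moreover have "M \<subseteq> K - gap_endpoints K" by (auto simp: M_def)
  ultimately show ?thesis unfolding lyap_def ent_def by (intro exI[of _ M]) simp
qed

end
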